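(* Let $G=(V,E)$ be an infinite, locally finite weighted graph with symmetric weight $\omega$, and let $N>0$. The following are equivalent: (i) there is a constant $C>0$ such that for all $t>0$, $\ \sup_{x,y\in V}p(t,x,y)\le Ct^{-\frac N2}$; (ii) there is a constant $C'>0$ such that for all $\varepsilon>0$ and every finitely supported $f:V\to[0,\infty)$, $$\langle f^2\log f\rangle\le\varepsilon\langle\Gamma(f)\rangle+\Big(C'-\frac N4\log\varepsilon\Big)\|f\|_2^2+\|f\|_2^2\log\|f\|_2 .$$
   Context: $G=(V,E)$ is an infinite graph with a symmetric weight function $\omega:V\times V\to[0,\infty)$, $\omega_{xy}=\omega_{yx}$; $x\sim y$ iff $\omega_{xy}>0$; loops are allowed. $G$ is locally finite: each vertex has finitely many neighbours. The degree $m(x)=\sum_{y\sim x}\omega_{xy}$ satisfies $0<m(x)<\infty$. $\|f\|_2=\big(\sum_xm(x)|f(x)|^2\big)^{1/2}$; $\langle f\rangle=\sum_{x\in V}m(x)f(x)$; convention $0\log0=0$. Gradient form: $\Gamma(f)(x)=\frac1{2m(x)}\sum_{y\sim x}\omega_{xy}(f(y)-f(x))^2$. Laplacian: $\Delta f(x)=\frac1{m(x)}\sum_{y\sim x}\omega_{xy}(f(y)-f(x))$, bounded and self-adjoint on $\ell^2(V,m)$. $P_t=e^{t\Delta}$ is the heat semigroup and $p(t,x,y)$ the heat kernel: $P_tf(x)=\sum_{y\in V}m(y)p(t,x,y)f(y)$. *)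

theory Defs
  imports "HOL-Analysis.Analysis"
begin

text \<open>
  The vertex set is the whole type \<open>'v\<close>; edges are encoded by the weight \<open>w\<close>, and loops
  (\<open>w x x > 0\<close>) are allowed. Connectedness is not assumed.
\<close>

definition nbrs :: "('v \<Rightarrow> 'v \<Rightarrow> real) \<Rightarrow> 'v \<Rightarrow> 'v set" where
  "nbrs w x = {y. w x y > 0}"

definition deg :: "('v \<Rightarrow> 'v \<Rightarrow> real) \<Rightarrow> 'v \<Rightarrow> real" where
  "deg w x = (\<Sum>y\<in>nbrs w x. w x y)"

locale weighted_graph =
  fixes w :: "'v \<Rightarrow> 'v \<Rightarrow> real"
  assumes weight_nonneg: "w x y \<ge> 0"
    and weight_sym: "w x y = w y x"
    and locally_finite: "finite (nbrs w x)"
    and deg_pos: "deg w x > 0"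

definition msum :: "('v \<Rightarrow> 'v \<Rightarrow> real) \<Rightarrow> ('v \<Rightarrow> real) \<Rightarrow> real" where
  "msum w f = (\<Sum>\<^sub>\<infinity>x. deg w x * f x)"

definition l2 :: "('v \<Rightarrow> 'v \<Rightarrow> real) \<Rightarrow> ('v \<Rightarrow> real) set" where
  "l2 w = {f. (\<lambda>x. deg w x * \<bar>f x\<bar>\<^sup>2) summable_on UNIV}"

text \<open>Only meaningful on \<open>l2 w\<close>: a divergent \<open>infsum\<close> has value \<open>0\<close>.\<close>

definition l2norm :: "('v \<Rightarrow> 'v \<Rightarrow> real) \<Rightarrow> ('v \<Rightarrow> real) \<Rightarrow> real" where
  "l2norm w f = sqrt (\<Sum>\<^sub>\<infinity>x. deg w x * \<bar>f x\<bar>\<^sup>2)"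

definition grad_form :: "('v \<Rightarrow> 'v \<Rightarrow> real) \<Rightarrow> ('v \<Rightarrow> real) \<Rightarrow> 'v \<Rightarrow> real" where
  "grad_form w f x = 1 / (2 * deg w x) * (\<Sum>y\<in>nbrs w x. w x y * (f y - f x)\<^sup>2)"

definition laplacian :: "('v \<Rightarrow> 'v \<Rightarrow> real) \<Rightarrow> ('v \<Rightarrow> real) \<Rightarrow> 'v \<Rightarrow> real" where
  "laplacian w f x = 1 / deg w x * (\<Sum>y\<in>nbrs w x. w x y * (f y - f x))"

definition exp_partial :: "('v \<Rightarrow> 'v \<Rightarrow> real) \<Rightarrow> real \<Rightarrow> ('v \<Rightarrow> real) \<Rightarrow> nat \<Rightarrow> 'v \<Rightarrow> real" where
  "exp_partial w t f n x = (\<Sum>k<n. t ^ k / fact k * (laplacian w ^^ k) f x)"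

text \<open>
  \<open>P\<^sub>t = e\<^bsup>t\<Delta>\<^esup>\<close> as an operator on \<open>l2 w\<close>: the limit in \<open>l2 w\<close> of the exponential series of the
  bounded operator \<open>t\<Delta>\<close>. Existence and uniqueness of the limit are \<open>heat_semigroup_l2\<close>,
  \<open>heat_semigroup_lim\<close> and \<open>heat_semigroup_eqI\<close> below.
\<close>

definition heat_semigroup :: "('v \<Rightarrow> 'v \<Rightarrow> real) \<Rightarrow> real \<Rightarrow> ('v \<Rightarrow> real) \<Rightarrow> 'v \<Rightarrow> real" where
  "heat_semigroup w t f =
     (THE g. g \<in> l2 w \<and> (\<lambda>n. l2norm w (\<lambda>x. exp_partial w t f n x - g x)) \<longlonglongrightarrow> 0)"

text \<open>
  Testing \<open>P\<^sub>t f(x) = (\<Sum>y. m(y) p(t,x,y) f(y))\<close> with the indicator of \<open>y\<close> forces this formula;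
  that the kernel so defined represents \<open>P\<^sub>t\<close> on all of \<open>l2 w\<close> is \<open>heat_kernel_has_sum\<close> below.
\<close>

definition heat_kernel :: "('v \<Rightarrow> 'v \<Rightarrow> real) \<Rightarrow> real \<Rightarrow> 'v \<Rightarrow> 'v \<Rightarrow> real" where
  "heat_kernel w t x y = heat_semigroup w t (indicator {y}) x / deg w y"


context weighted_graph
begin

lemma l2_le_iff:
  assumes "B \<ge> 0"
  shows "f \<in> l2 w \<and> l2norm w f \<le> B \<longleftrightarrow>
    (\<forall>F. finite F \<longrightarrow> L2_set (\<lambda>x. sqrt (deg w x) * f x) F \<le> B)"
proof -
  have sq: "(sqrt (deg w x) * f x)\<^sup>2 = deg w x * \<bar>f x\<bar>\<^sup>2" for x
    using deg_pos[of x] by (simp add: power_mult_distrib)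
  have nn: "deg w x * \<bar>f x\<bar>\<^sup>2 \<ge> 0" for x
    using deg_pos[of x] by simp
  have L: "L2_set (\<lambda>x. sqrt (deg w x) * f x) F \<le> B \<longleftrightarrow> (\<Sum>x\<in>F. deg w x * \<bar>f x\<bar>\<^sup>2) \<le> B\<^sup>2" for F
    unfolding L2_set_def sq using assms by (metis real_sqrt_le_iff real_sqrt_abs abs_of_nonneg)
  have N: "l2norm w f \<le> B \<longleftrightarrow> (\<Sum>\<^sub>\<infinity>x. deg w x * \<bar>f x\<bar>\<^sup>2) \<le> B\<^sup>2"
    unfolding l2norm_def using assms by (metis real_sqrt_le_iff real_sqrt_abs abs_of_nonneg)
  show ?thesis unfolding L N
  proof safe
    fix F :: "'v set" assume f: "f \<in> l2 w" "(\<Sum>\<^sub>\<infinity>x. deg w x * \<bar>f x\<bar>\<^sup>2) \<le> B\<^sup>2" "finite F"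
    have "(\<Sum>x\<in>F. deg w x * \<bar>f x\<bar>\<^sup>2) \<le> (\<Sum>\<^sub>\<infinity>x. deg w x * \<bar>f x\<bar>\<^sup>2)"
      by (rule finite_sum_le_infsum) (use f nn in \<open>auto simp: l2_def\<close>)
    then show "(\<Sum>x\<in>F. deg w x * \<bar>f x\<bar>\<^sup>2) \<le> B\<^sup>2" using f by simp
  next
    assume *: "\<forall>F. finite F \<longrightarrow> (\<Sum>x\<in>F. deg w x * \<bar>f x\<bar>\<^sup>2) \<le> B\<^sup>2"
    have s: "(\<lambda>x. deg w x * \<bar>f x\<bar>\<^sup>2) summable_on UNIV"
      by (rule nonneg_bdd_above_summable_on) (use * nn in \<open>auto intro!: bdd_aboveI2[where M="B\<^sup>2"]\<close>)
    then show "f \<in> l2 w" by (simp add: l2_def)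
    show "(\<Sum>\<^sub>\<infinity>x. deg w x * \<bar>f x\<bar>\<^sup>2) \<le> B\<^sup>2"
      by (rule infsum_le_finite_sums[OF s]) (use * in auto)
  qed
qed

lemma l2norm_nonneg: "l2norm w f \<ge> 0"
  unfolding l2norm_def by (intro real_sqrt_ge_zero infsum_nonneg mult_nonneg_nonneg)
    (use deg_pos in \<open>auto intro: less_imp_le\<close>)

lemma L2_set_le_l2norm:
  assumes "f \<in> l2 w" "finite F"
  shows "L2_set (\<lambda>x. sqrt (deg w x) * f x) F \<le> l2norm w f"
  using l2_le_iff[OF l2norm_nonneg, of f f] assms by blast

lemma l2I:
  assumes "\<And>F. finite F \<Longrightarrow> L2_set (\<lambda>x. sqrt (deg w x) * f x) F \<le> B"
  shows "f \<in> l2 w" "l2norm w f \<le> B"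
proof -
  have "B \<ge> 0" using assms[of "{}"] by simp
  from l2_le_iff[OF this, of f] assms show "f \<in> l2 w" "l2norm w f \<le> B" by auto
qed

lemma l2_pointwise:
  assumes "f \<in> l2 w"
  shows "\<bar>f x\<bar> \<le> l2norm w f / sqrt (deg w x)"
  using L2_set_le_l2norm[OF assms, of "{x}"] deg_pos[of x]
  by (simp add: L2_set_def field_simps abs_mult real_sqrt_mult)

lemma l2_add:
  assumes "f \<in> l2 w" "g \<in> l2 w"
  shows "(\<lambda>x. f x + g x) \<in> l2 w" "l2norm w (\<lambda>x. f x + g x) \<le> l2norm w f + l2norm w g"
proof -
  have "L2_set (\<lambda>x. sqrt (deg w x) * (f x + g x)) F \<le> l2norm w f + l2norm w g" if "finite F" for F
    unfolding distrib_left
    by (rule order_trans[OF L2_set_triangle_ineq add_mono[OF L2_set_le_l2norm L2_set_le_l2norm]])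
      (use assms that in auto)
  from l2I[OF this] show "(\<lambda>x. f x + g x) \<in> l2 w" "l2norm w (\<lambda>x. f x + g x) \<le> l2norm w f + l2norm w g"
    by auto
qed

lemma l2_scale:
  assumes "f \<in> l2 w"
  shows "(\<lambda>x. c * f x) \<in> l2 w" "l2norm w (\<lambda>x. c * f x) = \<bar>c\<bar> * l2norm w f"
proof -
  have eq: "(\<lambda>x. deg w x * \<bar>c * f x\<bar>\<^sup>2) = (\<lambda>x. c\<^sup>2 * (deg w x * \<bar>f x\<bar>\<^sup>2))"
    by (auto simp: power_mult_distrib)
  show "(\<lambda>x. c * f x) \<in> l2 w"
    using assms unfolding l2_def mem_Collect_eq eq by (rule summable_on_cmult_right)
  show "l2norm w (\<lambda>x. c * f x) = \<bar>c\<bar> * l2norm w f"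
    unfolding l2norm_def eq by (simp add: infsum_cmult_right' real_sqrt_mult)
qed

lemma l2_diff:
  assumes "f \<in> l2 w" "g \<in> l2 w"
  shows "(\<lambda>x. f x - g x) \<in> l2 w" "l2norm w (\<lambda>x. f x - g x) \<le> l2norm w f + l2norm w g"
  using l2_add[OF assms(1) l2_scale(1)[OF assms(2), of "-1"]] l2_scale(2)[OF assms(2), of "-1"]
  by simp_all

lemma l2_zero: "(\<lambda>x. 0) \<in> l2 w" "l2norm w (\<lambda>x. 0) = 0"
  by (simp_all add: l2_def l2norm_def)

lemma l2_sum:
  assumes "finite I" "\<And>i. i \<in> I \<Longrightarrow> f i \<in> l2 w"
  shows "(\<lambda>x. \<Sum>i\<in>I. f i x) \<in> l2 w \<and> l2norm w (\<lambda>x. \<Sum>i\<in>I. f i x) \<le> (\<Sum>i\<in>I. l2norm w (f i))"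
  using assms
proof (induction I)
  case empty
  then show ?case by (simp add: l2_zero)
next
  case (insert i I)
  then show ?case
    using l2_add[of "f i" "\<lambda>x. \<Sum>i\<in>I. f i x"] by fastforce
qed

lemma finite_support_l2:
  assumes "finite {x. f x \<noteq> 0}"
  shows "f \<in> l2 w"
  unfolding l2_def mem_Collect_eq
  by (rule finite_nonzero_values_imp_summable_on) (rule finite_subset[OF _ assms], auto)

lemma sum_weight_le_deg:
  assumes "finite F"
  shows "(\<Sum>x\<in>F. w x y) \<le> deg w y"
proof -
  have "(\<Sum>x\<in>F. w x y) = (\<Sum>x\<in>F \<inter> nbrs w y. w x y)"
    using assms weight_nonneg by (intro sum.mono_neutral_right)
      (auto simp: nbrs_def weight_sym[of _ y] less_le)
  also have "\<dots> \<le> (\<Sum>x\<in>nbrs w y. w x y)"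
    by (rule sum_mono2) (auto simp: locally_finite weight_nonneg)
  also have "\<dots> = deg w y" unfolding deg_def by (simp add: weight_sym[of _ y])
  finally show ?thesis .
qed

lemma average_l2:
  assumes "f \<in> l2 w"
  defines "g \<equiv> \<lambda>x. (\<Sum>y\<in>nbrs w x. w x y * f y) / deg w x"
  shows "g \<in> l2 w" "l2norm w g \<le> l2norm w f"
proof -
  have pt: "deg w x * (g x)\<^sup>2 \<le> (\<Sum>y\<in>nbrs w x. w x y * (f y)\<^sup>2)" for x
  proof -
    have "(\<Sum>y\<in>nbrs w x. w x y * f y) = (\<Sum>y\<in>nbrs w x. sqrt (w x y) * (sqrt (w x y) * f y))"
      by (intro sum.cong) (auto simp: mult.assoc[symmetric] weight_nonneg)
    then have "(\<Sum>y\<in>nbrs w x. w x y * f y)\<^sup>2 \<le>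
        (\<Sum>y\<in>nbrs w x. (sqrt (w x y))\<^sup>2) * (\<Sum>y\<in>nbrs w x. (sqrt (w x y) * f y)\<^sup>2)"
      by (simp only: Cauchy_Schwarz_ineq_sum)
    also have "\<dots> = deg w x * (\<Sum>y\<in>nbrs w x. w x y * (f y)\<^sup>2)"
      by (simp add: deg_def weight_nonneg power_mult_distrib)
    finally show ?thesis
      using deg_pos[of x] by (simp add: g_def field_simps power2_eq_square)
  qed
  have "L2_set (\<lambda>x. sqrt (deg w x) * g x) F \<le> l2norm w f" if F: "finite F" for F
  proof -
    define Y where "Y = (\<Union>x\<in>F. nbrs w x)"
    have Y: "finite Y" using F locally_finite by (auto simp: Y_def)
    have "(\<Sum>x\<in>F. (sqrt (deg w x) * g x)\<^sup>2) \<le> (\<Sum>x\<in>F. \<Sum>y\<in>nbrs w x. w x y * (f y)\<^sup>2)"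
      using pt by (intro sum_mono) (simp add: power_mult_distrib less_imp_le[OF deg_pos])
    also have "\<dots> \<le> (\<Sum>x\<in>F. \<Sum>y\<in>Y. w x y * (f y)\<^sup>2)"
      by (intro sum_mono sum_mono2) (use Y weight_nonneg in \<open>auto simp: Y_def\<close>)
    also have "\<dots> = (\<Sum>y\<in>Y. (\<Sum>x\<in>F. w x y) * (f y)\<^sup>2)"
      by (subst sum.swap) (simp add: sum_distrib_right)
    also have "\<dots> \<le> (\<Sum>y\<in>Y. deg w y * (f y)\<^sup>2)"
      by (intro sum_mono mult_right_mono sum_weight_le_deg F) auto
    also have "\<dots> = (\<Sum>y\<in>Y. (sqrt (deg w y) * f y)\<^sup>2)"
      by (simp add: power_mult_distrib less_imp_le[OF deg_pos])
    finally have "L2_set (\<lambda>x. sqrt (deg w x) * g x) F \<le> L2_set (\<lambda>x. sqrt (deg w x) * f x) Y"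
      by (simp add: L2_set_def)
    with L2_set_le_l2norm[OF assms(1) Y] show ?thesis by linarith
  qed
  from l2I[OF this] show "g \<in> l2 w" "l2norm w g \<le> l2norm w f" by auto
qed

lemma laplacian_average:
  "laplacian w f x = (\<Sum>y\<in>nbrs w x. w x y * f y) / deg w x - f x"
proof -
  have "(\<Sum>y\<in>nbrs w x. w x y * (f y - f x)) = (\<Sum>y\<in>nbrs w x. w x y * f y) - deg w x * f x"
    by (simp add: deg_def right_diff_distrib sum_subtractf sum_distrib_right)
  then show ?thesis using deg_pos[of x] by (simp add: laplacian_def field_simps)
qed

lemma laplacian_l2:
  assumes "f \<in> l2 w"
  shows "laplacian w f \<in> l2 w" "l2norm w (laplacian w f) \<le> 2 * l2norm w f"
proof -
  have eq: "laplacian w f = (\<lambda>x. (\<Sum>y\<in>nbrs w x. w x y * f y) / deg w x - f x)"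
    by (rule ext) (rule laplacian_average)
  show "laplacian w f \<in> l2 w" "l2norm w (laplacian w f) \<le> 2 * l2norm w f"
    unfolding eq using l2_diff[OF average_l2(1)[OF assms] assms] average_l2(2)[OF assms] by simp_all
qed

lemma laplacian_pow_l2:
  assumes "f \<in> l2 w"
  shows "(laplacian w ^^ k) f \<in> l2 w \<and> l2norm w ((laplacian w ^^ k) f) \<le> 2 ^ k * l2norm w f"
proof (induction k)
  case 0
  then show ?case using assms by simp
next
  case (Suc k)
  then show ?case
    using laplacian_l2[of "(laplacian w ^^ k) f"] by fastforce
qed

lemma exp_term_l2:
  assumes "f \<in> l2 w"
  shows "(\<lambda>x. t ^ k / fact k * (laplacian w ^^ k) f x) \<in> l2 w"
    "l2norm w (\<lambda>x. t ^ k / fact k * (laplacian w ^^ k) f x) \<le> (2 * \<bar>t\<bar>) ^ k / fact k * l2norm w f"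
proof -
  note L = laplacian_pow_l2[OF assms, of k]
  show "(\<lambda>x. t ^ k / fact k * (laplacian w ^^ k) f x) \<in> l2 w"
    using L l2_scale by blast
  have "\<bar>t ^ k / fact k\<bar> * l2norm w ((laplacian w ^^ k) f) \<le> \<bar>t ^ k / fact k\<bar> * (2 ^ k * l2norm w f)"
    using L by (intro mult_left_mono) auto
  then show "l2norm w (\<lambda>x. t ^ k / fact k * (laplacian w ^^ k) f x) \<le> (2 * \<bar>t\<bar>) ^ k / fact k * l2norm w f"
    unfolding l2_scale(2)[OF conjunct1[OF L]]
    by (simp add: power_mult_distrib power_abs abs_mult mult_ac)
qed

lemma exp_partial_l2: "f \<in> l2 w \<Longrightarrow> exp_partial w t f n \<in> l2 w"
  using l2_sum[of "{..<n}" "\<lambda>k x. t ^ k / fact k * (laplacian w ^^ k) f x"] exp_term_l2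
  by (simp add: exp_partial_def[abs_def])

lemma summable_exp_coeffs: "summable (\<lambda>k. (2 * \<bar>t\<bar>) ^ k / fact k * B)" for t B :: real
  using summable_exp[of "2 * \<bar>t\<bar>"] by (intro summable_mult2) (simp add: field_simps)

lemma summable_exp_terms:
  assumes "f \<in> l2 w"
  shows "summable (\<lambda>k. t ^ k / fact k * (laplacian w ^^ k) f x)"
proof (rule summable_comparison_test')
  show "summable (\<lambda>k. (2 * \<bar>t\<bar>) ^ k / fact k * (l2norm w f / sqrt (deg w x)))"
    by (rule summable_exp_coeffs)
  fix k
  have "\<bar>t ^ k / fact k * (laplacian w ^^ k) f x\<bar>
      \<le> l2norm w (\<lambda>x. t ^ k / fact k * (laplacian w ^^ k) f x) / sqrt (deg w x)"
    by (rule l2_pointwise[OF exp_term_l2(1)[OF assms]])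
  also have "\<dots> \<le> (2 * \<bar>t\<bar>) ^ k / fact k * l2norm w f / sqrt (deg w x)"
    by (intro divide_right_mono exp_term_l2 assms) (simp add: less_imp_le[OF deg_pos])
  finally show "norm (t ^ k / fact k * (laplacian w ^^ k) f x)
      \<le> (2 * \<bar>t\<bar>) ^ k / fact k * (l2norm w f / sqrt (deg w x))" by simp
qed

lemma exp_series_l2:
  fixes t :: real
  assumes f: "f \<in> l2 w"
  defines "g \<equiv> \<lambda>x. \<Sum>k. t ^ k / fact k * (laplacian w ^^ k) f x"
  shows "g \<in> l2 w" "(\<lambda>n. l2norm w (\<lambda>x. exp_partial w t f n x - g x)) \<longlonglongrightarrow> 0"
proof -
  let ?a = "\<lambda>k. (2 * \<bar>t\<bar>) ^ k / fact k * l2norm w f"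
  let ?u = "\<lambda>k x. t ^ k / fact k * (laplacian w ^^ k) f x"
  have a: "summable ?a" by (rule summable_exp_coeffs)
  have a0: "?a k \<ge> 0" for k using l2norm_nonneg by simp
  have lim: "(\<lambda>N. exp_partial w t f N x) \<longlonglongrightarrow> g x" for x
    using summable_LIMSEQ[OF summable_exp_terms[OF f]] by (simp add: exp_partial_def g_def)
  have bd: "L2_set (\<lambda>x. sqrt (deg w x) * (exp_partial w t f n x - g x)) F \<le> (\<Sum>k. ?a (k + n))"
    if F: "finite F" for F n
  proof (rule LIMSEQ_le_const2)
    show "(\<lambda>N. L2_set (\<lambda>x. sqrt (deg w x) * (exp_partial w t f n x - exp_partial w t f N x)) F)
        \<longlonglongrightarrow> L2_set (\<lambda>x. sqrt (deg w x) * (exp_partial w t f n x - g x)) F"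
      unfolding L2_set_def by (intro tendsto_intros lim)
    show "\<exists>N. \<forall>M\<ge>N. L2_set (\<lambda>x. sqrt (deg w x) * (exp_partial w t f n x - exp_partial w t f M x)) F
        \<le> (\<Sum>k. ?a (k + n))"
    proof (intro exI allI impI)
      fix M assume M: "n \<le> M"
      have d: "exp_partial w t f M x - exp_partial w t f n x = (\<Sum>k\<in>{n..<M}. ?u k x)" for x
        unfolding exp_partial_def using M
        by (simp add: lessThan_atLeast0 sum_diff_nat_ivl)
      have "L2_set (\<lambda>x. sqrt (deg w x) * (exp_partial w t f n x - exp_partial w t f M x)) F
          = L2_set (\<lambda>x. sqrt (deg w x) * (\<Sum>k\<in>{n..<M}. ?u k x)) F"
        unfolding L2_set_def d[symmetric]
        by (simp add: power_mult_distrib power2_commute[of "exp_partial w t f n _"])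
      also have "\<dots> \<le> l2norm w (\<lambda>x. \<Sum>k\<in>{n..<M}. ?u k x)"
        by (rule L2_set_le_l2norm[OF _ F]) (use l2_sum[of "{n..<M}" ?u] exp_term_l2(1)[OF f] in auto)
      also have "\<dots> \<le> (\<Sum>k\<in>{n..<M}. l2norm w (?u k))"
        using l2_sum[of "{n..<M}" ?u] exp_term_l2(1)[OF f] by auto
      also have "\<dots> \<le> (\<Sum>k\<in>{n..<M}. ?a k)"
        by (intro sum_mono exp_term_l2(2)[OF f])
      also have "\<dots> = (\<Sum>k<M - n. ?a (k + n))"
        using sum.shift_bounds_nat_ivl[of ?a 0 n "M - n"] M by (simp add: lessThan_atLeast0)
      also have "\<dots> \<le> (\<Sum>k. ?a (k + n))"
        by (rule sum_le_suminf[OF summable_ignore_initial_segment[OF a]]) (use a0 in auto)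
      finally show "L2_set (\<lambda>x. sqrt (deg w x) * (exp_partial w t f n x - exp_partial w t f M x)) F
          \<le> (\<Sum>k. ?a (k + n))" .
    qed
  qed
  note b = l2I[OF bd]
  have "(\<lambda>x. exp_partial w t f 0 x - (exp_partial w t f 0 x - g x)) \<in> l2 w"
    by (rule l2_diff(1)[OF exp_partial_l2[OF f] b(1)])
  then show "g \<in> l2 w" by simp
  show "(\<lambda>n. l2norm w (\<lambda>x. exp_partial w t f n x - g x)) \<longlonglongrightarrow> 0"
  proof (rule tendsto_sandwich[OF _ _ tendsto_const])
    show "(\<lambda>n. \<Sum>k. ?a (k + n)) \<longlonglongrightarrow> 0" by (rule suminf_exist_split2[OF a])
  qed (use l2norm_nonneg b(2) in auto)
qed

lemma l2_lim_pointwise: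
  assumes "f \<in> l2 w" "g \<in> l2 w" "(\<lambda>n. l2norm w (\<lambda>x. exp_partial w t f n x - g x)) \<longlonglongrightarrow> 0"
  shows "g x = (\<Sum>k. t ^ k / fact k * (laplacian w ^^ k) f x)"
proof -
  have "(\<lambda>n. exp_partial w t f n x - g x) \<longlonglongrightarrow> 0"
  proof (rule Lim_null_comparison)
    show "\<forall>\<^sub>F n in sequentially. norm (exp_partial w t f n x - g x)
        \<le> l2norm w (\<lambda>x. exp_partial w t f n x - g x) / sqrt (deg w x)"
      using l2_pointwise[OF l2_diff(1)[OF exp_partial_l2[OF assms(1)] assms(2)]] by simp
    show "(\<lambda>n. l2norm w (\<lambda>x. exp_partial w t f n x - g x) / sqrt (deg w x)) \<longlonglongrightarrow> 0"
      using tendsto_divide[OF assms(3) tendsto_const[of "sqrt (deg w x)"]] deg_pos[of x] by simp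
  qed
  then have "(\<lambda>n. exp_partial w t f n x) \<longlonglongrightarrow> g x" by (simp add: LIM_zero_iff)
  moreover have "(\<lambda>n. exp_partial w t f n x) \<longlonglongrightarrow> (\<Sum>k. t ^ k / fact k * (laplacian w ^^ k) f x)"
    using summable_LIMSEQ[OF summable_exp_terms[OF assms(1)]] by (simp add: exp_partial_def)
  ultimately show ?thesis using LIMSEQ_unique by blast
qed

lemma heat_semigroup_eqI:
  assumes "f \<in> l2 w" "g \<in> l2 w" "(\<lambda>n. l2norm w (\<lambda>x. exp_partial w t f n x - g x)) \<longlonglongrightarrow> 0"
  shows "heat_semigroup w t f = g"
  unfolding heat_semigroup_def
proof (rule the_equality)
  fix h assume h: "h \<in> l2 w \<and> (\<lambda>n. l2norm w (\<lambda>x. exp_partial w t f n x - h x)) \<longlonglongrightarrow> 0"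
  show "h = g"
  proof
    fix x
    show "h x = g x"
      using l2_lim_pointwise[OF assms(1), of h t x] l2_lim_pointwise[OF assms, of x] h by simp
  qed
qed (use assms in auto)

lemma heat_semigroup_series:
  assumes "f \<in> l2 w"
  shows "heat_semigroup w t f = (\<lambda>x. \<Sum>k. t ^ k / fact k * (laplacian w ^^ k) f x)"
  by (rule heat_semigroup_eqI[OF assms exp_series_l2[OF assms]])

lemma heat_semigroup_l2: "f \<in> l2 w \<Longrightarrow> heat_semigroup w t f \<in> l2 w"
  using exp_series_l2(1) by (simp only: heat_semigroup_series)

lemma heat_semigroup_lim:
  "f \<in> l2 w \<Longrightarrow> (\<lambda>n. l2norm w (\<lambda>x. exp_partial w t f n x - heat_semigroup w t f x)) \<longlonglongrightarrow> 0"
  using exp_series_l2(2) by (simp only: heat_semigroup_series)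

lemma laplacian_pow_add:
  "(laplacian w ^^ k) (\<lambda>x. f x + g x) = (\<lambda>x. (laplacian w ^^ k) f x + (laplacian w ^^ k) g x)"
proof (induction k)
  case (Suc k)
  show ?case unfolding funpow.simps o_apply Suc
    by (rule ext) (simp add: laplacian_average distrib_left sum.distrib add_divide_distrib)
qed simp

lemma laplacian_pow_scale:
  "(laplacian w ^^ k) (\<lambda>x. c * f x) = (\<lambda>x. c * (laplacian w ^^ k) f x)"
proof (induction k)
  case (Suc k)
  show ?case unfolding funpow.simps o_apply Suc
    by (rule ext)
      (simp add: laplacian_average mult.left_commute[of _ c] sum_distrib_left[symmetric] right_diff_distrib)
qed simp

lemma heat_semigroup_add:
  assumes "f \<in> l2 w" "g \<in> l2 w"
  shows "heat_semigroup w t (\<lambda>x. f x + g x) x = heat_semigroup w t f x + heat_semigroup w t g x"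
  using suminf_add[OF summable_exp_terms[OF assms(1), of t x] summable_exp_terms[OF assms(2), of t x]]
  by (simp add: heat_semigroup_series assms l2_add(1) laplacian_pow_add distrib_left)

lemma heat_semigroup_scale:
  assumes "f \<in> l2 w"
  shows "heat_semigroup w t (\<lambda>x. c * f x) x = c * heat_semigroup w t f x"
  using suminf_mult[OF summable_exp_terms[OF assms(1), of t x], of c]
  by (simp add: heat_semigroup_series assms l2_scale(1) laplacian_pow_scale mult.left_commute[of _ c])

lemma heat_semigroup_bound:
  assumes f: "f \<in> l2 w"
  shows "\<bar>heat_semigroup w t f x\<bar> \<le> (\<Sum>k. (2 * \<bar>t\<bar>) ^ k / fact k) / sqrt (deg w x) * l2norm w f"
proof -
  let ?c = "l2norm w f / sqrt (deg w x)"
  have s: "summable (\<lambda>k. (2 * \<bar>t\<bar>) ^ k / fact k)" using summable_exp_coeffs[of t 1] by simp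
  have "\<bar>t ^ k / fact k * (laplacian w ^^ k) f x\<bar> \<le> (2 * \<bar>t\<bar>) ^ k / fact k * ?c" for k
  proof -
    have "\<bar>t ^ k / fact k * (laplacian w ^^ k) f x\<bar>
        \<le> l2norm w (\<lambda>x. t ^ k / fact k * (laplacian w ^^ k) f x) / sqrt (deg w x)"
      by (rule l2_pointwise[OF exp_term_l2(1)[OF f]])
    also have "\<dots> \<le> (2 * \<bar>t\<bar>) ^ k / fact k * l2norm w f / sqrt (deg w x)"
      by (intro divide_right_mono exp_term_l2 f) (simp add: less_imp_le[OF deg_pos])
    finally show ?thesis by simp
  qed
  then have "norm (\<Sum>k. t ^ k / fact k * (laplacian w ^^ k) f x) \<le> (\<Sum>k. (2 * \<bar>t\<bar>) ^ k / fact k * ?c)"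
    by (intro norm_suminf_le summable_mult2 s) simp
  also have "\<dots> = (\<Sum>k. (2 * \<bar>t\<bar>) ^ k / fact k) * ?c"
    by (rule suminf_mult2[OF s, symmetric])
  finally show ?thesis by (simp add: heat_semigroup_series f)
qed

lemma heat_semigroup_restrict:
  assumes "finite F"
  shows "(\<lambda>z. if z \<in> F then f z else 0) \<in> l2 w \<and>
    heat_semigroup w t (\<lambda>z. if z \<in> F then f z else 0) x =
      (\<Sum>y\<in>F. deg w y * heat_kernel w t x y * f y)"
  using assms
proof (induction F)
  case empty
  have "heat_semigroup w t (\<lambda>z. 0 * (0::real)) x = 0"
    using heat_semigroup_scale[OF l2_zero(1), of t 0 x] by simp
  then show ?case by (simp add: l2_zero)
next
  case (insert y F)
  have i: "indicator {y} \<in> l2 w"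
    by (rule finite_support_l2) (simp add: indicator_def)
  have eq: "(\<lambda>z. if z \<in> insert y F then f z else 0) =
      (\<lambda>z. f y * indicator {y} z + (if z \<in> F then f z else 0))"
    using insert.hyps by (auto simp: indicator_def)
  have "heat_semigroup w t (indicator {y}) x = deg w y * heat_kernel w t x y"
    using deg_pos[of y] by (simp add: heat_kernel_def)
  then show ?case
    unfolding eq using insert l2_add(1)[OF l2_scale(1)[OF i]]
    by (simp add: heat_semigroup_add l2_scale(1)[OF i] heat_semigroup_scale[OF i])
qed

lemma heat_kernel_has_sum:
  assumes f: "f \<in> l2 w"
  shows "((\<lambda>y. deg w y * heat_kernel w t x y * f y) has_sum heat_semigroup w t f x) UNIV"
proof -
  let ?K = "(\<Sum>k. (2 * \<bar>t\<bar>) ^ k / fact k) / sqrt (deg w x)"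
  let ?q = "\<lambda>y. deg w y * \<bar>f y\<bar>\<^sup>2"
  let ?S = "\<lambda>F. \<Sum>y\<in>F. deg w y * heat_kernel w t x y * f y"
  have s: "?q summable_on UNIV" using f by (simp add: l2_def)
  have bd: "\<bar>?S F - heat_semigroup w t f x\<bar> \<le> ?K * sqrt (infsum ?q UNIV - sum ?q F)"
    if F: "finite F" for F
  proof -
    let ?r = "\<lambda>z. if z \<in> F then f z else 0" and ?c = "\<lambda>z. if z \<in> F then 0 else f z"
    have r: "?r \<in> l2 w" "heat_semigroup w t ?r x = ?S F"
      using heat_semigroup_restrict[OF F] by blast+
    have "(\<lambda>z. f z - ?r z) = ?c" by auto
    then have c: "?c \<in> l2 w" using l2_diff(1)[OF f r(1)] by simp
    have "(\<lambda>z. ?r z + ?c z) = f" by auto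
    then have 1: "heat_semigroup w t f x = ?S F + heat_semigroup w t ?c x"
      using heat_semigroup_add[OF r(1) c, of t x] r(2) by simp
    have "(\<Sum>\<^sub>\<infinity>z. deg w z * \<bar>?c z\<bar>\<^sup>2) = infsum ?q (UNIV - F)"
      by (rule infsum_cong_neutral) auto
    also have "\<dots> = infsum ?q UNIV - sum ?q F"
      using infsum_Diff[OF s, of F] F by (simp add: summable_on_finite)
    finally have "l2norm w ?c = sqrt (infsum ?q UNIV - sum ?q F)" by (simp add: l2norm_def)
    then show ?thesis using heat_semigroup_bound[OF c, of t x] 1 by simp
  qed
  have "((\<lambda>F. ?S F - heat_semigroup w t f x) \<longlongrightarrow> 0) (finite_subsets_at_top UNIV)"
  proof (rule Lim_null_comparison)
    show "\<forall>\<^sub>F F in finite_subsets_at_top UNIV. norm (?S F - heat_semigroup w t f x)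
        \<le> ?K * sqrt (infsum ?q UNIV - sum ?q F)"
      using bd by (auto intro!: eventually_finite_subsets_at_top_weakI)
    have "((\<lambda>F. ?K * sqrt (infsum ?q UNIV - sum ?q F)) \<longlongrightarrow> ?K * sqrt (infsum ?q UNIV - infsum ?q UNIV))
        (finite_subsets_at_top UNIV)"
      by (intro tendsto_intros infsum_tendsto s)
    then show "((\<lambda>F. ?K * sqrt (infsum ?q UNIV - sum ?q F)) \<longlongrightarrow> 0) (finite_subsets_at_top UNIV)"
      by simp
  qed
  then show ?thesis by (simp add: has_sum_def LIM_zero_iff)
qed

end

end

theory Submission
  imports Defs
begin

text \<open>
  From the kernel bound to the log-Sobolev inequality: for \<open>u\<^sub>s = P\<^sub>s f\<close>, the derivative
  \<open>\<langle>f\<^sup>2 \<Delta>u\<^sub>s / u\<^sub>s\<rangle>\<close> of \<open>\<langle>f\<^sup>2 log u\<^sub>s\<rangle>\<close> is at least \<open>- \<langle>\<Gamma>(f)\<rangle>\<close> by the arithmetic-geometric mean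
  inequality, so \<open>\<langle>f\<^sup>2 log f\<rangle> \<le> \<epsilon> \<langle>\<Gamma>(f)\<rangle> + \<langle>f\<^sup>2 log P\<^sub>\<epsilon> f\<rangle>\<close>, and Cauchy-Schwarz bounds \<open>P\<^sub>\<epsilon> f\<close> in the
  supremum norm by \<open>\<parallel>f\<parallel>\<^sub>2\<close>.

  Conversely, run the heat flow killed outside a finite set \<open>S\<close>, started at a unit point mass, and let
  \<open>\<phi>(s) = \<parallel>u\<^sub>s\<parallel>\<^sub>2\<^sup>2\<close>. Since \<open>\<parallel>u\<^sub>s\<parallel>\<^sub>1 \<le> 1\<close>, Jensen's inequality gives \<open>\<langle>u\<^sup>2 log u\<rangle> \<ge> \<phi> log \<phi>\<close>, and the
  log-Sobolev inequality with \<open>\<epsilon> = s\<close> becomes \<open>(s log \<phi>(s))' \<le> 2C' - (N/2) log s\<close>. Integration yields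
  \<open>\<phi>(t) \<le> C t\<^bsup>-N/2\<^esup>\<close>, uniformly in \<open>S\<close>; the heat kernel at time \<open>2t\<close> is a limit of pairings of two such
  flows at time \<open>t\<close>.
\<close>

text \<open>Transition operator of the walk killed on leaving \<open>S\<close>: jumps out of
  \<open>S\<close> are dropped while the full degree stays in the denominator. On functions
  supported in \<open>S\<close>, subtracting the identity gives the Dirichlet Laplacian; for
  \<open>S = UNIV\<close> it gives \<open>laplacian w\<close>.\<close>

definition avg :: "('v \<Rightarrow> 'v \<Rightarrow> real) \<Rightarrow> 'v set \<Rightarrow> ('v \<Rightarrow> real) \<Rightarrow> 'v \<Rightarrow> real" where
  "avg w S f x = (if x \<in> S then (\<Sum>y\<in>nbrs w x \<inter> S. w x y * f y) / deg w x else 0)"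

text \<open>
  The heat semigroup of the walk killed on leaving \<open>S\<close>. Expanding \<open>e\<^bsup>t(A - I)\<^esup>\<close> as \<open>e\<^bsup>-t\<^esup> e\<^bsup>tA\<^esup>\<close> makes
  positivity visible term by term. Functions are meant to be supported in \<open>S\<close>: outside, the value is
  \<open>e\<^bsup>-t\<^esup> f x\<close>.
\<close>

definition killed_heat :: "('v \<Rightarrow> 'v \<Rightarrow> real) \<Rightarrow> 'v set \<Rightarrow> real \<Rightarrow> ('v \<Rightarrow> real) \<Rightarrow> 'v \<Rightarrow> real" where
  "killed_heat w S t f x = exp (- t) * (\<Sum>k. t ^ k / fact k * (avg w S ^^ k) f x)"

section \<open>Elementary facts about real functions\<close>

lemma abs_le_sum_support:
  fixes f :: "'a \<Rightarrow> real"
  assumes "finite S" "\<And>x. f x \<ge> 0" "\<And>x. x \<notin> S \<Longrightarrow> f x = 0"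
  shows "\<bar>f y\<bar> \<le> sum f S"
proof (cases "y \<in> S")
  case True
  then show ?thesis using member_le_sum[of y S f] assms by simp
next
  case False
  then show ?thesis using assms by (simp add: sum_nonneg)
qed

text \<open>Only the endpoint 0 is at issue; there the substitution s = 1/x reduces the claim to ln
  x / x tending to 0 at infinity. It is needed because the differential inequality for the killed
  flow is integrated from time 0.\<close>

lemma continuous_on_mult_ln: "continuous_on {0..} (\<lambda>s::real. s * ln s)"
proof -
  have "((\<lambda>x::real. - (ln x / x)) \<longlongrightarrow> - 0) at_top"
    by (intro tendsto_minus ln_x_over_x_tendsto_0)
  moreover have "\<forall>\<^sub>F x::real in at_top. - (ln x / x) = inverse x * ln (inverse x)"
    by (rule eventually_mono[OF eventually_gt_at_top[of 0]]) (simp add: ln_inverse divide_inverse)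
  ultimately have "((\<lambda>x::real. inverse x * ln (inverse x)) \<longlongrightarrow> - 0) at_top"
    by (rule Lim_transform_eventually)
  then have 0: "((\<lambda>s::real. s * ln s) \<longlongrightarrow> 0) (at_right 0)"
    by (simp add: filterlim_at_right_to_top)
  have "((\<lambda>s::real. s * ln s) \<longlongrightarrow> a * ln a) (at a within {0..})" if "a \<ge> 0" for a
  proof (cases "a = 0")
    case True
    then show ?thesis using 0 by (simp add: at_within_Ici_at_right)
  qed (auto intro!: tendsto_intros)
  then show ?thesis by (simp add: continuous_on_def)
qed

context weighted_graph
begin

section \<open>Weighted sums and the energy of finitely supported functions\<close>

lemma weight_zero_iff: "w x y = 0 \<longleftrightarrow> y \<notin> nbrs w x"
  using weight_nonneg[of x y] by (auto simp: nbrs_def)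

lemma nbrs_sym: "y \<in> nbrs w x \<longleftrightarrow> x \<in> nbrs w y"
  by (simp add: nbrs_def weight_sym[of x])

text \<open>Weights vanish off the neighbourhood, so neighbourhoods varying with x can be replaced
  by one fixed finite set, after which double sums may be swapped.\<close>

lemma sum_nbrs_superset:
  assumes "finite T" "\<And>y. y \<in> nbrs w x \<Longrightarrow> y \<notin> T \<Longrightarrow> g y = 0"
  shows "(\<Sum>y\<in>nbrs w x. w x y * g y) = (\<Sum>y\<in>T. w x y * g y)"
proof -
  have "(\<Sum>y\<in>nbrs w x. w x y * g y) = (\<Sum>y\<in>nbrs w x \<inter> T. w x y * g y)"
    using assms(2) by (intro sum.mono_neutral_right) (auto simp: locally_finite)
  also have "\<dots> = (\<Sum>y\<in>T. w x y * g y)"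
    using assms(1) by (intro sum.mono_neutral_left) (auto simp: weight_zero_iff)
  finally show ?thesis .
qed

lemma msum_finite_support:
  assumes "finite S" "\<And>x. x \<notin> S \<Longrightarrow> f x = 0"
  shows "msum w f = (\<Sum>x\<in>S. deg w x * f x)"
proof -
  have "msum w f = (\<Sum>\<^sub>\<infinity>x\<in>S. deg w x * f x)"
    unfolding msum_def by (rule infsum_cong_neutral) (use assms in auto)
  then show ?thesis using assms by simp
qed

lemma l2norm_finite_support:
  assumes "finite S" "\<And>x. x \<notin> S \<Longrightarrow> f x = 0"
  shows "(l2norm w f)\<^sup>2 = (\<Sum>x\<in>S. deg w x * (f x)\<^sup>2)"
proof -
  have "(\<Sum>\<^sub>\<infinity>x. deg w x * \<bar>f x\<bar>\<^sup>2) = (\<Sum>x\<in>S. deg w x * (f x)\<^sup>2)"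
    using msum_finite_support[of S "\<lambda>x. \<bar>f x\<bar>\<^sup>2"] assms by (simp add: msum_def)
  moreover have "(\<Sum>x\<in>S. deg w x * (f x)\<^sup>2) \<ge> 0"
    by (intro sum_nonneg mult_nonneg_nonneg) (auto intro: less_imp_le[OF deg_pos])
  ultimately show ?thesis unfolding l2norm_def by simp
qed

text \<open>Expanding the square, the terms in f(x)^2 and in f(y)^2 each give half of the diagonal
  part, by symmetry of \<open>w\<close>. Edges leaving \<open>S\<close> contribute too, which is why
  the full degree appears there.\<close>

lemma msum_grad_form:
  assumes S: "finite S" and f: "\<And>x. x \<notin> S \<Longrightarrow> f x = 0"
  shows "msum w (grad_form w f) =
    (\<Sum>x\<in>S. deg w x * (f x)\<^sup>2) - (\<Sum>x\<in>S. \<Sum>y\<in>S. w x y * (f x * f y))"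
proof -
  \<comment> \<open>\<open>grad_form w f\<close> may be nonzero at neighbours of \<open>S\<close>,
    where f itself vanishes. With them included, summing \<open>w x y\<close> over x in
    \<open>T\<close> recovers the full degree of each y in \<open>S\<close>.\<close>
  define T where "T = S \<union> (\<Union>x\<in>S. nbrs w x)"
  have T: "finite T" "S \<subseteq> T" using S locally_finite by (auto simp: T_def)
  have g: "deg w x * grad_form w f x =
      ((\<Sum>y\<in>S. w x y * (f y)\<^sup>2) - 2 * f x * (\<Sum>y\<in>S. w x y * f y) + deg w x * (f x)\<^sup>2) / 2" for x
  proof -
    have "(\<Sum>y\<in>nbrs w x. w x y * (f y - f x)\<^sup>2) =
        (\<Sum>y\<in>nbrs w x. w x y * (f y)\<^sup>2) - 2 * f x * (\<Sum>y\<in>nbrs w x. w x y * f y) + deg w x * (f x)\<^sup>2"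
      unfolding deg_def sum_distrib_left sum_distrib_right sum_subtractf[symmetric] sum.distrib[symmetric]
      by (intro sum.cong) (auto simp: power2_eq_square algebra_simps)
    moreover have "(\<Sum>y\<in>nbrs w x. w x y * (f y)\<^sup>2) = (\<Sum>y\<in>S. w x y * (f y)\<^sup>2)"
      "(\<Sum>y\<in>nbrs w x. w x y * f y) = (\<Sum>y\<in>S. w x y * f y)"
      by (rule sum_nbrs_superset; use S f in simp)+
    ultimately show ?thesis using deg_pos[of x] by (simp add: grad_form_def)
  qed
  have z: "grad_form w f x = 0" if "x \<notin> T" for x
  proof -
    have "f y = 0" if "y \<in> nbrs w x" for y
      using f[of y] that \<open>x \<notin> T\<close> nbrs_sym[of y x] by (auto simp: T_def)
    moreover have "f x = 0" using f \<open>x \<notin> T\<close> by (auto simp: T_def)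
    ultimately show ?thesis by (simp add: grad_form_def)
  qed
  have r: "(\<Sum>x\<in>T. w x y) = deg w y" if "y \<in> S" for y
    using sum_nbrs_superset[of T y "\<lambda>_. 1"] that T by (auto simp: deg_def T_def weight_sym[of _ y])
  have 1: "(\<Sum>x\<in>T. \<Sum>y\<in>S. w x y * (f y)\<^sup>2) = (\<Sum>y\<in>S. deg w y * (f y)\<^sup>2)"
    by (subst sum.swap) (simp add: sum_distrib_right[symmetric] r)
  have 2: "(\<Sum>x\<in>T. 2 * f x * (\<Sum>y\<in>S. w x y * f y)) = 2 * (\<Sum>x\<in>S. \<Sum>y\<in>S. w x y * (f x * f y))"
  proof -
    have "(\<Sum>x\<in>T. 2 * f x * (\<Sum>y\<in>S. w x y * f y)) = (\<Sum>x\<in>S. 2 * f x * (\<Sum>y\<in>S. w x y * f y))"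
      using T f by (intro sum.mono_neutral_right) auto
    then show ?thesis by (simp add: sum_distrib_left mult_ac)
  qed
  have 3: "(\<Sum>x\<in>T. deg w x * (f x)\<^sup>2) = (\<Sum>x\<in>S. deg w x * (f x)\<^sup>2)"
    using T f by (intro sum.mono_neutral_right) auto
  have "msum w (grad_form w f) = (\<Sum>x\<in>T. ((\<Sum>y\<in>S. w x y * (f y)\<^sup>2) - 2 * f x * (\<Sum>y\<in>S. w x y * f y) + deg w x * (f x)\<^sup>2) / 2)"
    unfolding g[symmetric] by (rule msum_finite_support[OF T(1) z])
  also have "\<dots> = ((\<Sum>x\<in>T. \<Sum>y\<in>S. w x y * (f y)\<^sup>2) - (\<Sum>x\<in>T. 2 * f x * (\<Sum>y\<in>S. w x y * f y))
      + (\<Sum>x\<in>T. deg w x * (f x)\<^sup>2)) / 2"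
    by (simp only: sum_divide_distrib[symmetric] sum.distrib sum_subtractf)
  finally show ?thesis unfolding 1 2 3 by simp
qed

section \<open>The averaging operator and the killed heat flow\<close>

lemma deg_avg:
  assumes "finite S" "x \<in> S"
  shows "deg w x * avg w S f x = (\<Sum>y\<in>S. w x y * f y)"
proof -
  have "(\<Sum>y\<in>nbrs w x \<inter> S. w x y * f y) = (\<Sum>y\<in>S. w x y * f y)"
    using assms(1) by (intro sum.mono_neutral_left) (auto simp: weight_zero_iff)
  then show ?thesis using assms(2) deg_pos[of x] by (simp add: avg_def)
qed

lemma avg_nonneg: "(\<And>y. f y \<ge> 0) \<Longrightarrow> avg w S f x \<ge> 0"
  by (auto simp: avg_def weight_nonneg intro!: divide_nonneg_pos sum_nonneg deg_pos)

lemma avg_pow_nonneg: "(\<And>y. f y \<ge> 0) \<Longrightarrow> (avg w S ^^ k) f x \<ge> 0"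
  by (induction k arbitrary: x) (auto intro: avg_nonneg)

text \<open>The coefficients of the average sum to at most 1, because the denominator is the degree
  in the whole graph.\<close>

lemma avg_bound:
  assumes "\<And>y. \<bar>f y\<bar> \<le> B"
  shows "\<bar>avg w S f x\<bar> \<le> B"
proof -
  have B: "B \<ge> 0" using assms[of x] by linarith
  have "\<bar>\<Sum>y\<in>nbrs w x \<inter> S. w x y * f y\<bar> \<le> (\<Sum>y\<in>nbrs w x \<inter> S. w x y * B)"
    by (intro order_trans[OF sum_abs] sum_mono) (simp add: abs_mult weight_nonneg assms mult_left_mono)
  also have "\<dots> \<le> (\<Sum>y\<in>nbrs w x. w x y * B)"
    by (intro sum_mono2) (auto simp: locally_finite weight_nonneg B)
  also have "\<dots> = B * deg w x" by (simp add: deg_def sum_distrib_right[symmetric])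
  finally show ?thesis using B deg_pos[of x] by (auto simp: avg_def abs_divide divide_le_eq)
qed

lemma avg_pow_bound: "(\<And>y. \<bar>f y\<bar> \<le> B) \<Longrightarrow> \<bar>(avg w S ^^ k) f x\<bar> \<le> B"
  by (induction k arbitrary: x) (auto intro: avg_bound)

text \<open>The powers of \<open>avg w S\<close> preserve the bound \<open>B\<close>, so an
  exponential series dominates, for \<open>t\<close> of either sign. The absolute form is what the
  Cauchy product with the series of exp (- t) requires.\<close>

lemma killed_heat_summable_norm:
  assumes "\<And>y. \<bar>f y\<bar> \<le> B"
  shows "summable (\<lambda>k. norm (t ^ k / fact k * (avg w S ^^ k) f x))"
proof (rule summable_comparison_test')
  show "summable (\<lambda>k. \<bar>t\<bar> ^ k / fact k * B)"
    using summable_exp[of "\<bar>t\<bar>"] by (intro summable_mult2) (simp add: field_simps)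
  show "norm (norm (t ^ k / fact k * (avg w S ^^ k) f x)) \<le> \<bar>t\<bar> ^ k / fact k * B" for k
    using avg_pow_bound[where f=f and B=B and S=S and k=k and x=x] assms
    by (simp add: abs_mult power_abs divide_right_mono mult_left_mono)
qed

lemma killed_heat_summable:
  "(\<And>y. \<bar>f y\<bar> \<le> B) \<Longrightarrow> summable (\<lambda>k. t ^ k / fact k * (avg w S ^^ k) f x)"
  by (rule summable_norm_cancel[OF killed_heat_summable_norm])

text \<open>By local finiteness each value of the average is a finite sum, even for infinite
  \<open>S\<close>, so pointwise summability suffices for the exchange.\<close>

lemma avg_suminf:
  assumes "\<And>y. summable (\<lambda>k. a k y)"
  shows "(\<Sum>k. avg w S (a k) x) = avg w S (\<lambda>y. \<Sum>k. a k y) x"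
proof (cases "x \<in> S")
  case True
  have "(\<Sum>k. avg w S (a k) x) = (\<Sum>k. \<Sum>y\<in>nbrs w x \<inter> S. w x y * a k y) / deg w x"
    using True assms by (simp add: avg_def suminf_divide summable_sum summable_mult)
  also have "(\<Sum>k. \<Sum>y\<in>nbrs w x \<inter> S. w x y * a k y) = (\<Sum>y\<in>nbrs w x \<inter> S. w x y * (\<Sum>k. a k y))"
    using assms by (subst suminf_sum) (auto intro: summable_mult simp: suminf_mult)
  finally show ?thesis using True by (simp add: avg_def)
qed (simp add: avg_def)

lemma avg_scale: "avg w S (\<lambda>y. c * f y) x = c * avg w S f x"
  by (simp add: avg_def mult.left_commute[of _ c] sum_distrib_left[symmetric])

lemma killed_heat_deriv:
  assumes "\<And>y. \<bar>f y\<bar> \<le> B"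
  shows "((\<lambda>t. killed_heat w S t f x) has_real_derivative
    avg w S (killed_heat w S t f) x - killed_heat w S t f x) (at t)"
proof -
  define c where "c k = (avg w S ^^ k) f x / fact k" for k
  let ?E = "\<lambda>t y. \<Sum>k. t ^ k / fact k * (avg w S ^^ k) f y"
  note s = killed_heat_summable[where f=f, OF assms]
  have E: "?E t x = (\<Sum>k. c k * t ^ k)" for t by (simp add: c_def mult.commute)
  have "summable (\<lambda>k. c k * u ^ k)" for u
    using s[where t=u and x=x] by (simp add: c_def mult.commute)
  then have "((\<lambda>u. \<Sum>k. c k * u ^ k) has_real_derivative (\<Sum>k. diffs c k * t ^ k)) (at t)"
    by (rule termdiffs_strong_converges_everywhere)
  \<comment> \<open>\<open>diffs c k\<close> is (k + 1) times \<open>c (Suc k)\<close>: the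
    factorial drops by one step and one extra application of \<open>avg w S\<close> remains.\<close>
  also have "(\<Sum>k. diffs c k * t ^ k) = (\<Sum>k. avg w S (\<lambda>y. t ^ k / fact k * (avg w S ^^ k) f y) x)"
    unfolding avg_scale by (intro suminf_cong) (simp add: diffs_def c_def)
  also have "\<dots> = avg w S (?E t) x" by (rule avg_suminf[OF s])
  finally have "((\<lambda>u. ?E u x) has_real_derivative avg w S (?E t) x) (at t)" unfolding E .
  then have "((\<lambda>u. exp (- u) * ?E u x) has_real_derivative
      - exp (- t) * ?E t x + exp (- t) * avg w S (?E t) x) (at t)"
    by (auto intro!: derivative_eq_intros simp: algebra_simps)
  then show ?thesis unfolding killed_heat_def[abs_def] avg_scale by simp
qed

lemma killed_heat_0: "killed_heat w S 0 f x = f x"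
proof -
  have "(\<Sum>k. 0 ^ k / fact k * (avg w S ^^ k) f x) = (\<Sum>k\<in>{0}. 0 ^ k / fact k * (avg w S ^^ k) f x)"
    by (intro suminf_finite) auto
  then show ?thesis by (simp add: killed_heat_def)
qed

text \<open>All terms are nonnegative. Taking n = 0 gives positivity, n = 1 a strictly positive
  lower bound on the support of f, and general n the passage from finite \<open>S\<close> to the
  whole graph.\<close>

lemma killed_heat_partial_sum_le:
  assumes "\<And>y. \<bar>f y\<bar> \<le> B" "\<And>y. f y \<ge> 0" "t \<ge> 0"
  shows "exp (- t) * (\<Sum>k<n. t ^ k / fact k * (avg w S ^^ k) f x) \<le> killed_heat w S t f x"
  unfolding killed_heat_def
  by (intro mult_left_mono sum_le_suminf killed_heat_summable[where f=f, OF assms(1)])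
    (use assms avg_pow_nonneg in auto)

lemma killed_heat_ge:
  assumes "\<And>y. \<bar>f y\<bar> \<le> B" "\<And>y. f y \<ge> 0" "t \<ge> 0"
  shows "exp (- t) * f x \<le> killed_heat w S t f x"
  using killed_heat_partial_sum_le[OF assms, where n=1 and S=S and x=x] by simp

lemma killed_heat_nonneg:
  assumes "\<And>y. \<bar>f y\<bar> \<le> B" "\<And>y. f y \<ge> 0" "t \<ge> 0"
  shows "killed_heat w S t f x \<ge> 0"
  using killed_heat_partial_sum_le[OF assms, where n=0 and S=S and x=x] by simp

lemma avg_pow_outside: "(\<And>y. y \<notin> S \<Longrightarrow> f y = 0) \<Longrightarrow> x \<notin> S \<Longrightarrow> (avg w S ^^ k) f x = 0"
  by (cases k) (auto simp: avg_def)

lemma killed_heat_outside: "(\<And>y. y \<notin> S \<Longrightarrow> f y = 0) \<Longrightarrow> x \<notin> S \<Longrightarrow> killed_heat w S t f x = 0"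
  by (simp add: killed_heat_def avg_pow_outside)

lemma exp_series_sums: "(\<lambda>k. t ^ k / fact k * c) sums (exp t * c)" for t c :: real
  using sums_mult2[OF exp_converges[of t], of c] by (simp add: field_simps)

lemma killed_heat_le:
  assumes "\<And>y. 0 \<le> f y" "\<And>y. f y \<le> B" "t \<ge> 0"
  shows "killed_heat w S t f x \<le> B"
proof -
  have b: "\<And>y. \<bar>f y\<bar> \<le> B" using assms(1,2) by simp
  have "(\<Sum>k. t ^ k / fact k * (avg w S ^^ k) f x) \<le> (\<Sum>k. t ^ k / fact k * B)"
    using assms(3) avg_pow_bound[where f=f and B=B and S=S and x=x, OF b]
    by (intro suminf_le killed_heat_summable[where f=f, OF b] sums_summable[OF exp_series_sums] mult_left_mono)
      (auto dest: abs_le_D1)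
  also have "\<dots> = exp t * B" by (rule sums_unique[OF exp_series_sums, symmetric])
  finally have "exp (- t) * (\<Sum>k. t ^ k / fact k * (avg w S ^^ k) f x) \<le> exp (- t) * (exp t * B)"
    by (intro mult_left_mono) auto
  also have "\<dots> = B" by (simp add: mult.assoc[symmetric] exp_add[symmetric])
  finally show ?thesis by (simp add: killed_heat_def)
qed

text \<open>By symmetry of the weights the column sums over \<open>S\<close> are bounded by the
  degree, so killing can only lose mass.\<close>

lemma avg_l1_le:
  assumes "finite S" "\<And>y. f y \<ge> 0"
  shows "(\<Sum>x\<in>S. deg w x * avg w S f x) \<le> (\<Sum>x\<in>S. deg w x * f x)"
proof -
  have "(\<Sum>x\<in>S. deg w x * avg w S f x) = (\<Sum>x\<in>S. \<Sum>y\<in>S. w x y * f y)"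
    using assms by (simp add: deg_avg)
  also have "\<dots> = (\<Sum>y\<in>S. (\<Sum>x\<in>S. w x y) * f y)"
    by (subst sum.swap) (simp add: sum_distrib_right)
  also have "\<dots> \<le> (\<Sum>y\<in>S. deg w y * f y)"
    by (intro sum_mono mult_right_mono sum_weight_le_deg assms)
  finally show ?thesis .
qed

lemma avg_pow_l1_le:
  assumes "finite S" "\<And>y. f y \<ge> 0"
  shows "(\<Sum>x\<in>S. deg w x * (avg w S ^^ k) f x) \<le> (\<Sum>x\<in>S. deg w x * f x)"
proof (induction k)
  case (Suc k)
  then show ?case
    using avg_l1_le[where f="(avg w S ^^ k) f", OF assms(1) avg_pow_nonneg[OF assms(2)]] by (simp add: order_trans)
qed simp

lemma killed_heat_l1_le:
  assumes "finite S" "\<And>y. \<bar>f y\<bar> \<le> B" "\<And>y. f y \<ge> 0" "t \<ge> 0"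
  shows "(\<Sum>x\<in>S. deg w x * killed_heat w S t f x) \<le> (\<Sum>x\<in>S. deg w x * f x)" (is "_ \<le> ?M")
proof -
  note s = killed_heat_summable[where f=f, OF assms(2)]
  let ?a = "\<lambda>k x. t ^ k / fact k * (avg w S ^^ k) f x"
  have "(\<Sum>x\<in>S. deg w x * (\<Sum>k. ?a k x)) = (\<Sum>x\<in>S. \<Sum>k. deg w x * ?a k x)"
    by (intro sum.cong refl suminf_mult[symmetric] s)
  also have "\<dots> = (\<Sum>k. \<Sum>x\<in>S. deg w x * ?a k x)"
    by (intro suminf_sum[symmetric] summable_mult s)
  also have "\<dots> \<le> (\<Sum>k. t ^ k / fact k * ?M)"
  proof (intro suminf_le sums_summable[OF exp_series_sums] summable_sum summable_mult s)
    fix k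
    have "(\<Sum>x\<in>S. deg w x * ?a k x) = t ^ k / fact k * (\<Sum>x\<in>S. deg w x * (avg w S ^^ k) f x)"
      by (simp add: sum_distrib_left mult_ac)
    also have "\<dots> \<le> t ^ k / fact k * ?M"
      using assms by (intro mult_left_mono avg_pow_l1_le) auto
    finally show "(\<Sum>x\<in>S. deg w x * ?a k x) \<le> t ^ k / fact k * ?M" .
  qed
  also have "\<dots> = exp t * ?M" by (rule sums_unique[OF exp_series_sums, symmetric])
  finally have "exp (- t) * (\<Sum>x\<in>S. deg w x * (\<Sum>k. ?a k x)) \<le> exp (- t) * (exp t * ?M)"
    by (intro mult_left_mono) auto
  also have "\<dots> = ?M" by (simp add: mult.assoc[symmetric] exp_add[symmetric])
  finally show ?thesis by (simp add: killed_heat_def sum_distrib_left mult_ac)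
qed

section \<open>The heat semigroup as the flow with \<open>S = UNIV\<close>\<close>

lemma laplacian_eq_avg: "laplacian w f x = avg w UNIV f x - f x"
  by (simp add: laplacian_average avg_def)

lemma avg_sum: "avg w S (\<lambda>y. \<Sum>i\<in>I. c i * g i y) x = (\<Sum>i\<in>I. c i * avg w S (g i) x)"
proof (cases "x \<in> S")
  case True
  have "(\<Sum>y\<in>nbrs w x \<inter> S. w x y * (\<Sum>i\<in>I. c i * g i y)) =
      (\<Sum>i\<in>I. c i * (\<Sum>y\<in>nbrs w x \<inter> S. w x y * g i y))"
    by (simp add: sum_distrib_left mult_ac) (rule sum.swap)
  then have "avg w S (\<lambda>y. \<Sum>i\<in>I. c i * g i y) x =
      (\<Sum>i\<in>I. c i * (\<Sum>y\<in>nbrs w x \<inter> S. w x y * g i y)) / deg w x"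
    using True by (simp add: avg_def)
  then show ?thesis using True by (subst (asm) sum_divide_distrib) (simp add: avg_def)
qed (simp add: avg_def)

text \<open>Binomial theorem for \<open>avg w UNIV\<close> minus the identity, two commuting
  operators; the induction is Pascal's rule.\<close>

lemma laplacian_pow_binomial:
  "(laplacian w ^^ k) f x = (\<Sum>i\<le>k. real (k choose i) * (-1) ^ i * (avg w UNIV ^^ (k - i)) f x)"
proof (induction k arbitrary: x)
  case (Suc k)
  let ?a = "\<lambda>i. (avg w UNIV ^^ i) f x"
  have "(laplacian w ^^ Suc k) f x =
      (\<Sum>i\<le>k. real (k choose i) * (-1) ^ i * ?a (Suc (k - i))) - (\<Sum>i\<le>k. real (k choose i) * (-1) ^ i * ?a (k - i))"
    by (simp add: laplacian_eq_avg Suc[abs_def] avg_sum)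
  \<comment> \<open>The added term at i = k + 1 vanishes because \<open>k choose Suc k\<close> is
    0.\<close>
  also have "(\<Sum>i\<le>k. real (k choose i) * (-1) ^ i * ?a (Suc (k - i))) =
      (\<Sum>i\<le>Suc k. real (k choose i) * (-1) ^ i * ?a (Suc k - i))"
    by (simp add: Suc_diff_le)
  also have "\<dots> = ?a (Suc k) - (\<Sum>i\<le>k. real (k choose Suc i) * (-1) ^ i * ?a (k - i))"
    by (subst sum.atMost_Suc_shift) (simp add: sum_negf)
  also have "\<dots> - (\<Sum>i\<le>k. real (k choose i) * (-1) ^ i * ?a (k - i)) =
      (\<Sum>i\<le>Suc k. real (Suc k choose i) * (-1) ^ i * ?a (Suc k - i))"
  proof -
    have "(\<Sum>i\<le>Suc k. real (Suc k choose i) * (-1) ^ i * ?a (Suc k - i)) =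
        ?a (Suc k) - (\<Sum>i\<le>k. (real (k choose i) + real (k choose Suc i)) * (-1) ^ i * ?a (k - i))"
      by (subst sum.atMost_Suc_shift) (simp add: sum_negf)
    then show ?thesis by (simp add: distrib_right sum.distrib)
  qed
  finally show ?case .
qed simp

text \<open>The Cauchy product of the series of exp (- t) with that of the averaging operator has
  the terms of the Laplacian's exponential series, by the binomial expansion. This transfers
  positivity and the maximum principle to \<open>heat_semigroup\<close>.\<close>

lemma heat_semigroup_eq_killed_heat:
  assumes "finite {x. f x \<noteq> 0}" "\<And>y. \<bar>f y\<bar> \<le> B"
  shows "heat_semigroup w t f x = killed_heat w UNIV t f x"
proof -
  let ?a = "\<lambda>k. (- t) ^ k / fact k" and ?b = "\<lambda>k. t ^ k / fact k * (avg w UNIV ^^ k) f x"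
  have "(\<lambda>k. \<Sum>i\<le>k. ?a i * ?b (k - i)) sums ((\<Sum>k. ?a k) * (\<Sum>k. ?b k))"
  proof (rule Cauchy_product_sums)
    show "summable (\<lambda>k. norm (?a k))"
      using sums_summable[OF exp_series_sums[of "\<bar>t\<bar>" 1]] by (simp add: power_abs)
  qed (rule killed_heat_summable_norm[OF assms(2)])
  moreover have "(\<Sum>k. ?a k) = exp (- t)"
    using sums_unique[OF exp_series_sums[of "- t" 1]] by simp
  moreover have "(\<Sum>i\<le>k. ?a i * ?b (k - i)) = t ^ k / fact k * (laplacian w ^^ k) f x" for k
    unfolding laplacian_pow_binomial sum_distrib_left
  proof (intro sum.cong refl)
    fix i assume "i \<in> {..k}"
    then have "i \<le> k" by simp
    have "t ^ k = t ^ i * t ^ (k - i)" using \<open>i \<le> k\<close> by (simp add: power_add[symmetric])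
    then show "?a i * ?b (k - i) =
        t ^ k / fact k * (real (k choose i) * (-1) ^ i * (avg w UNIV ^^ (k - i)) f x)"
      by (simp add: binomial_fact[OF \<open>i \<le> k\<close>] power_minus[of t])
  qed
  ultimately have "(\<Sum>k. t ^ k / fact k * (laplacian w ^^ k) f x) = exp (- t) * (\<Sum>k. ?b k)"
    by (simp add: sums_iff)
  then show ?thesis
    by (simp add: heat_semigroup_series[OF finite_support_l2[OF assms(1)]] killed_heat_def)
qed

section \<open>From the kernel bound to the log-Sobolev inequality\<close>

text \<open>For each pair x, y the two terms f(x)^2 u(y)/u(x) and f(y)^2 u(x)/u(y) add up to at
  least 2 f(x) f(y); symmetry of \<open>w\<close> merges them after summation.\<close>

lemma avg_quotient_ge:
  assumes S: "finite S" and f: "\<And>x. x \<notin> S \<Longrightarrow> f x = 0"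
    and u: "\<And>x. u x \<ge> 0" "\<And>x. x \<in> S \<Longrightarrow> u x > 0"
  shows "- msum w (grad_form w f) \<le> (\<Sum>x\<in>S. deg w x * (f x)\<^sup>2 * ((avg w UNIV u x - u x) / u x))"
proof -
  let ?q = "\<lambda>x y. w x y * ((f x)\<^sup>2 * (u y / u x))"
  have "2 * (\<Sum>x\<in>S. \<Sum>y\<in>S. w x y * (f x * f y)) = (\<Sum>x\<in>S. \<Sum>y\<in>S. w x y * (2 * (f x * f y)))"
    by (simp add: sum_distrib_left mult_ac)
  also have "\<dots> \<le> (\<Sum>x\<in>S. \<Sum>y\<in>S. ?q x y + ?q y x)"
  proof (intro sum_mono)
    fix x y assume "x \<in> S" "y \<in> S"
    then have p: "u x > 0" "u y > 0" using u by auto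
    have "0 \<le> (f x * u y - f y * u x)\<^sup>2 / (u x * u y)" using p by simp
    also have "\<dots> = (f x)\<^sup>2 * (u y / u x) + (f y)\<^sup>2 * (u x / u y) - 2 * (f x * f y)"
      using p by (simp add: field_simps power2_eq_square)
    finally have "w x y * (2 * (f x * f y)) \<le> w x y * ((f x)\<^sup>2 * (u y / u x) + (f y)\<^sup>2 * (u x / u y))"
      by (intro mult_left_mono weight_nonneg) simp
    then show "w x y * (2 * (f x * f y)) \<le> ?q x y + ?q y x"
      by (simp add: distrib_left weight_sym[of y x])
  qed
  also have "\<dots> = 2 * (\<Sum>x\<in>S. \<Sum>y\<in>S. ?q x y)"
    unfolding sum.distrib by (subst (2) sum.swap) simp
  finally have "(\<Sum>x\<in>S. \<Sum>y\<in>S. w x y * (f x * f y)) \<le> (\<Sum>x\<in>S. \<Sum>y\<in>S. ?q x y)" by simp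
  \<comment> \<open>Passing from \<open>S\<close> to all neighbours only adds nonnegative terms, so
    \<open>u\<close> need not vanish outside \<open>S\<close>.\<close>
  also have "\<dots> \<le> (\<Sum>x\<in>S. deg w x * (f x)\<^sup>2 * (avg w UNIV u x / u x))"
  proof (rule sum_mono)
    fix x assume x: "x \<in> S"
    have "(\<Sum>y\<in>S. w x y * u y) = (\<Sum>y\<in>nbrs w x \<inter> S. w x y * u y)"
      using S by (intro sum.mono_neutral_right) (auto simp: weight_zero_iff)
    also have "\<dots> \<le> (\<Sum>y\<in>nbrs w x. w x y * u y)"
      by (intro sum_mono2) (auto simp: locally_finite weight_nonneg u)
    also have "\<dots> = deg w x * avg w UNIV u x"
      using deg_pos[of x] by (simp add: avg_def)
    finally have "(f x)\<^sup>2 / u x * (\<Sum>y\<in>S. w x y * u y) \<le> (f x)\<^sup>2 / u x * (deg w x * avg w UNIV u x)"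
      using u(2)[OF x] by (intro mult_left_mono) auto
    then show "(\<Sum>y\<in>S. ?q x y) \<le> deg w x * (f x)\<^sup>2 * (avg w UNIV u x / u x)"
      by (simp add: sum_distrib_left sum_divide_distrib mult_ac)
  qed
  finally have "- msum w (grad_form w f) \<le>
      (\<Sum>x\<in>S. deg w x * (f x)\<^sup>2 * (avg w UNIV u x / u x)) - (\<Sum>x\<in>S. deg w x * (f x)\<^sup>2)"
    using msum_grad_form[OF S, of f] f by simp
  also have "\<dots> = (\<Sum>x\<in>S. deg w x * (f x)\<^sup>2 * ((avg w UNIV u x - u x) / u x))"
    unfolding sum_subtractf[symmetric]
  proof (rule sum.cong[OF refl])
    fix x assume "x \<in> S"
    then have "u x \<noteq> 0" using u(2)[of x] by simp
    then show "deg w x * (f x)\<^sup>2 * (avg w UNIV u x / u x) - deg w x * (f x)\<^sup>2 =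
        deg w x * (f x)\<^sup>2 * ((avg w UNIV u x - u x) / u x)"
      by (simp add: field_simps)
  qed
  finally show ?thesis .
qed

text \<open>By \<open>avg_quotient_ge\<close> the function \<open>?h\<close> is nondecreasing, and
  its values at 0 and \<open>t\<close> are compared. \<open>S\<close> is the exact support of
  \<open>f\<close>, so the flow is strictly positive on \<open>S\<close> and its logarithm is
  differentiable.\<close>

lemma sum_ln_le_killed_heat:
  assumes S: "finite S" and f: "\<And>x. f x \<ge> 0" "\<And>x. f x \<noteq> 0 \<longleftrightarrow> x \<in> S" and t: "t \<ge> 0"
  shows "(\<Sum>x\<in>S. deg w x * (f x)\<^sup>2 * ln (f x)) \<le>
    t * msum w (grad_form w f) + (\<Sum>x\<in>S. deg w x * (f x)\<^sup>2 * ln (killed_heat w UNIV t f x))"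
proof -
  let ?E = "msum w (grad_form w f)"
  have b: "\<bar>f y\<bar> \<le> sum f S" for y
    by (rule abs_le_sum_support) (use S f in auto)
  define H where "H s = killed_heat w UNIV s f" for s
  have H0: "H s x \<ge> 0" if "s \<ge> 0" for s x
    unfolding H_def by (rule killed_heat_nonneg[OF b f(1) that])
  have Hpos: "H s x > 0" if "s \<ge> 0" "x \<in> S" for s x
  proof -
    have "f x > 0" using f that(2) by (metis less_eq_real_def)
    then have "0 < exp (- s) * f x" by simp
    also have "\<dots> \<le> H s x" unfolding H_def by (rule killed_heat_ge[OF b f(1) that(1)])
    finally show ?thesis .
  qed
  have H': "((\<lambda>s. H s x) has_real_derivative avg w UNIV (H s) x - H s x) (at s)" for s x
    unfolding H_def by (rule killed_heat_deriv[OF b])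
  let ?h = "\<lambda>s. (\<Sum>x\<in>S. deg w x * (f x)\<^sup>2 * ln (H s x)) + s * ?E"
  have "?h 0 \<le> ?h t"
  proof (rule DERIV_nonneg_imp_nondecreasing[OF t])
    fix s assume s: "0 \<le> s" "s \<le> t"
    have "((\<lambda>s. ln (H s x)) has_real_derivative (avg w UNIV (H s) x - H s x) / H s x) (at s)"
      if "x \<in> S" for x
      using DERIV_chain2[OF DERIV_ln_divide[OF Hpos[OF s(1) that]] H'[of x s]] by simp
    then have "(?h has_real_derivative
        (\<Sum>x\<in>S. deg w x * (f x)\<^sup>2 * ((avg w UNIV (H s) x - H s x) / H s x)) + ?E) (at s)"
      by (intro DERIV_add DERIV_sum DERIV_cmult) (auto intro!: derivative_eq_intros)
    moreover have "- ?E \<le> (\<Sum>x\<in>S. deg w x * (f x)\<^sup>2 * ((avg w UNIV (H s) x - H s x) / H s x))"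
      by (rule avg_quotient_ge[OF S]) (use f H0[OF s(1)] Hpos[OF s(1)] in auto)
    ultimately show "\<exists>y. (?h has_real_derivative y) (at s) \<and> y \<ge> 0"
      by (intro exI conjI) auto
  qed
  then show ?thesis by (simp add: H_def killed_heat_0)
qed

lemma abs_point_mass_le: "\<bar>indicator {y} z / deg w y\<bar> \<le> 1 / deg w y"
  using deg_pos[of y] by (simp add: indicator_def)

text \<open>Linearity moves the division by \<open>deg w y\<close> into the initial datum, which
  becomes a point mass of total mass 1.\<close>

lemma heat_kernel_eq_killed_heat:
  "heat_kernel w t x y = killed_heat w UNIV t (\<lambda>z. indicator {y} z / deg w y) x"
proof -
  have fin: "finite {x. indicator {y} x \<noteq> (0::real)}" "finite {x. indicator {y} x / deg w y \<noteq> 0}"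
    by (rule finite_subset[of _ "{y}"]; auto simp: indicator_def)+
  have "heat_kernel w t x y = heat_semigroup w t (\<lambda>z. indicator {y} z / deg w y) x"
    using heat_semigroup_scale[OF finite_support_l2[OF fin(1)], of t "1 / deg w y" x]
    by (simp add: heat_kernel_def)
  also have "\<dots> = killed_heat w UNIV t (\<lambda>z. indicator {y} z / deg w y) x"
    by (rule heat_semigroup_eq_killed_heat[OF fin(2) abs_point_mass_le])
  finally show ?thesis .
qed

lemma heat_kernel_nonneg: "t \<ge> 0 \<Longrightarrow> heat_kernel w t x y \<ge> 0"
  unfolding heat_kernel_eq_killed_heat
  by (intro killed_heat_nonneg[OF abs_point_mass_le]) (auto simp: less_imp_le[OF deg_pos])

text \<open>The sum is the semigroup applied to the indicator of \<open>S\<close>, and the flow does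
  not exceed the upper bound of its datum.\<close>

lemma heat_kernel_sum_le_1:
  assumes "finite S" "t \<ge> 0"
  shows "(\<Sum>y\<in>S. deg w y * heat_kernel w t x y) \<le> 1"
proof -
  have "(\<Sum>y\<in>S. deg w y * heat_kernel w t x y) = heat_semigroup w t (\<lambda>z. if z \<in> S then 1 else 0) x"
    using heat_semigroup_restrict[OF assms(1), of "\<lambda>_. 1" t x] by simp
  also have "\<dots> = killed_heat w UNIV t (\<lambda>z. if z \<in> S then 1 else 0) x"
    by (rule heat_semigroup_eq_killed_heat[where B=1]) (use assms in auto)
  also have "\<dots> \<le> 1" by (rule killed_heat_le) (use assms in auto)
  finally show ?thesis .
qed

text \<open>Cauchy-Schwarz with respect to the weights \<open>deg w y * heat_kernel w t x y\<close>,
  whose total mass is at most 1; the remaining kernel factor is bounded by \<open>K\<close>.\<close>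

lemma heat_semigroup_sq_le:
  assumes S: "finite S" and f: "\<And>x. x \<notin> S \<Longrightarrow> f x = 0" and t: "t \<ge> 0"
    and K: "\<And>y. heat_kernel w t x y \<le> K"
  shows "(heat_semigroup w t f x)\<^sup>2 \<le> K * (l2norm w f)\<^sup>2"
proof -
  let ?m = "\<lambda>y. deg w y * heat_kernel w t x y"
  have m: "?m y \<ge> 0" for y
    using heat_kernel_nonneg[OF t, of x y] deg_pos[of y] by simp
  have "(\<lambda>z. if z \<in> S then f z else 0) = f" using f by auto
  then have "heat_semigroup w t f x = (\<Sum>y\<in>S. ?m y * f y)"
    using heat_semigroup_restrict[OF S, of f t x] by simp
  also have "\<dots> = (\<Sum>y\<in>S. sqrt (?m y) * (sqrt (?m y) * f y))"
    by (intro sum.cong refl) (simp add: mult.assoc[symmetric] m del: real_sqrt_mult)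
  finally have "(heat_semigroup w t f x)\<^sup>2 \<le> (\<Sum>y\<in>S. (sqrt (?m y))\<^sup>2) * (\<Sum>y\<in>S. (sqrt (?m y) * f y)\<^sup>2)"
    by (simp only: Cauchy_Schwarz_ineq_sum)
  also have "\<dots> = (\<Sum>y\<in>S. ?m y) * (\<Sum>y\<in>S. ?m y * (f y)\<^sup>2)"
    by (simp only: power_mult_distrib real_sqrt_pow2[OF m])
  also have "\<dots> \<le> 1 * (\<Sum>y\<in>S. ?m y * (f y)\<^sup>2)"
    by (intro mult_right_mono heat_kernel_sum_le_1[OF S t] sum_nonneg mult_nonneg_nonneg m) auto
  also have "\<dots> \<le> (\<Sum>y\<in>S. K * (deg w y * (f y)\<^sup>2))"
  proof -
    have "heat_kernel w t x y * (deg w y * (f y)\<^sup>2) \<le> K * (deg w y * (f y)\<^sup>2)" for y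
      by (intro mult_right_mono K) (simp add: less_imp_le[OF deg_pos])
    then show ?thesis unfolding mult_1 by (intro sum_mono) (simp add: mult_ac)
  qed
  also have "\<dots> = K * (l2norm w f)\<^sup>2"
    by (simp add: l2norm_finite_support[OF S f] sum_distrib_left)
  finally show ?thesis .
qed

text \<open>The entropy estimate is used at time \<epsilon>; the constants ln C / 2 and N / 4 are
  half the logarithm of the kernel bound, since the sup bound controls the square of the
  flow.\<close>

lemma log_sobolev_of_heat_kernel_bound:
  assumes C: "C > 0" and K: "\<And>x y. heat_kernel w \<epsilon> x y \<le> C * \<epsilon> powr (- (N / 2))"
    and \<epsilon>: "\<epsilon> > 0" and f: "\<And>x. f x \<ge> 0" "finite {x. f x \<noteq> 0}"
  shows "msum w (\<lambda>x. (f x)\<^sup>2 * ln (f x)) \<le> \<epsilon> * msum w (grad_form w f)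
    + (ln C / 2 - N / 4 * ln \<epsilon>) * (l2norm w f)\<^sup>2 + (l2norm w f)\<^sup>2 * ln (l2norm w f)"
proof -
  define S where "S = {x. f x \<noteq> 0}"
  have S: "finite S" "\<And>x. f x \<noteq> 0 \<longleftrightarrow> x \<in> S" "\<And>x. x \<notin> S \<Longrightarrow> f x = 0" using f by (auto simp: S_def)
  let ?n = "l2norm w f" and ?H = "killed_heat w UNIV \<epsilon> f"
  have n2: "?n\<^sup>2 = (\<Sum>x\<in>S. deg w x * (f x)\<^sup>2)" using l2norm_finite_support S by blast
  have b: "\<bar>f y\<bar> \<le> sum f S" for y
    by (rule abs_le_sum_support) (use S f in auto)
  have lnH: "ln (?H x) \<le> ln C / 2 - N / 4 * ln \<epsilon> + ln ?n" if x: "x \<in> S" for x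
  proof -
    have "f x > 0" using f(1)[of x] S(2)[of x] x by simp
    then have "0 < deg w x * (f x)\<^sup>2" using deg_pos by simp
    also have "\<dots> \<le> ?n\<^sup>2" unfolding n2
      using x S(1) by (intro member_le_sum) (auto intro: mult_nonneg_nonneg less_imp_le[OF deg_pos])
    finally have n: "?n > 0" using l2norm_nonneg[of f] by (simp add: zero_less_power2)
    have "0 < exp (- \<epsilon>) * f x" using \<open>f x > 0\<close> by simp
    also have "\<dots> \<le> ?H x" by (rule killed_heat_ge[OF b f(1)]) (use \<epsilon> in simp)
    finally have H: "?H x > 0" .
    have "(?H x)\<^sup>2 \<le> C * \<epsilon> powr (- (N / 2)) * ?n\<^sup>2"
      using heat_semigroup_sq_le[where f=f and x=x, OF S(1,3) _ K] \<epsilon>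
      by (simp add: heat_semigroup_eq_killed_heat[OF f(2) b])
    then have "ln ((?H x)\<^sup>2) \<le> ln (C * \<epsilon> powr (- (N / 2)) * ?n\<^sup>2)"
      using H by (intro ln_mono) auto
    also have "\<dots> = ln C - N / 2 * ln \<epsilon> + 2 * ln ?n"
      using C \<epsilon> n by (simp add: ln_mult ln_powr ln_realpow)
    finally show ?thesis using H by (simp add: ln_realpow)
  qed
  have "msum w (\<lambda>x. (f x)\<^sup>2 * ln (f x)) = (\<Sum>x\<in>S. deg w x * (f x)\<^sup>2 * ln (f x))"
    using msum_finite_support[OF S(1), of "\<lambda>x. (f x)\<^sup>2 * ln (f x)"] S(3) by (simp add: mult.assoc)
  also have "\<dots> \<le> \<epsilon> * msum w (grad_form w f) + (\<Sum>x\<in>S. deg w x * (f x)\<^sup>2 * ln (?H x))"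
    using sum_ln_le_killed_heat[OF S(1) f(1) S(2)] \<epsilon> by simp
  also have "(\<Sum>x\<in>S. deg w x * (f x)\<^sup>2 * ln (?H x)) \<le>
      (\<Sum>x\<in>S. deg w x * (f x)\<^sup>2 * (ln C / 2 - N / 4 * ln \<epsilon> + ln ?n))"
    by (intro sum_mono mult_left_mono lnH) (auto intro: mult_nonneg_nonneg less_imp_le[OF deg_pos])
  also have "\<dots> = ?n\<^sup>2 * (ln C / 2 - N / 4 * ln \<epsilon> + ln ?n)"
    unfolding n2 by (simp add: sum_distrib_right)
  finally show ?thesis by (simp add: algebra_simps)
qed

section \<open>Self-adjointness and decay of the killed flow\<close>

lemma sum_deg_avg_sym:
  assumes "finite S"
  shows "(\<Sum>x\<in>S. deg w x * (avg w S f x * g x)) = (\<Sum>x\<in>S. deg w x * (f x * avg w S g x))"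
proof -
  have "(\<Sum>x\<in>S. deg w x * (avg w S f x * g x)) = (\<Sum>x\<in>S. \<Sum>y\<in>S. w x y * (f y * g x))"
    using assms by (simp add: mult.assoc[symmetric] deg_avg sum_distrib_right)
  also have "\<dots> = (\<Sum>y\<in>S. \<Sum>x\<in>S. w y x * (f y * g x))"
    by (subst sum.swap) (simp add: weight_sym)
  also have "\<dots> = (\<Sum>x\<in>S. f x * (deg w x * avg w S g x))"
    using assms by (simp add: deg_avg sum_distrib_left mult_ac)
  finally show ?thesis by (simp add: mult_ac)
qed

text \<open>The pairing of the flow of \<open>f\<close> at time \<open>s\<close> with that of \<open>g\<close> at time \<open>2t - s\<close> is constant in \<open>s\<close>.\<close>

lemma killed_heat_pairing:
  assumes S: "finite S" and f: "\<And>x. \<bar>f x\<bar> \<le> B" and g: "\<And>x. \<bar>g x\<bar> \<le> D"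
  shows "(\<Sum>z\<in>S. deg w z * (killed_heat w S (2 * t) f z * g z)) =
    (\<Sum>z\<in>S. deg w z * (killed_heat w S t f z * killed_heat w S t g z))"
proof -
  let ?F = "\<lambda>s. killed_heat w S s f" and ?G = "\<lambda>s. killed_heat w S (2 * t - s) g"
  let ?p = "\<lambda>s. \<Sum>z\<in>S. deg w z * (?F s z * ?G s z)"
  have "(?p has_real_derivative 0) (at s)" for s
  proof -
    have G: "((\<lambda>s. ?G s z) has_real_derivative - (avg w S (?G s) z - ?G s z)) (at s)" for z
    proof -
      have "((\<lambda>s. 2 * t - s) has_real_derivative - 1) (at s)"
        by (auto intro!: derivative_eq_intros)
      from DERIV_chain2[OF killed_heat_deriv[where f=g and t="2 * t - s" and S=S and x=z, OF g] this]
      show ?thesis by simp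
    qed
    have "(?p has_real_derivative (\<Sum>z\<in>S. deg w z * ((avg w S (?F s) z - ?F s z) * ?G s z
        + - (avg w S (?G s) z - ?G s z) * ?F s z))) (at s)"
      by (intro DERIV_sum DERIV_cmult DERIV_mult killed_heat_deriv[OF f] G)
    \<comment> \<open>The identity parts of the two generators cancel, leaving the self-adjointness
      defect of \<open>avg w S\<close>.\<close>
    also have "(\<Sum>z\<in>S. deg w z * ((avg w S (?F s) z - ?F s z) * ?G s z
        + - (avg w S (?G s) z - ?G s z) * ?F s z)) =
      (\<Sum>z\<in>S. deg w z * (avg w S (?F s) z * ?G s z)) - (\<Sum>z\<in>S. deg w z * (?F s z * avg w S (?G s) z))"
      unfolding sum_subtractf[symmetric] by (intro sum.cong refl) (simp add: algebra_simps)
    also have "\<dots> = 0" by (simp add: sum_deg_avg_sym[OF S])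
    finally show ?thesis .
  qed
  then have "?p (2 * t) = ?p t" using DERIV_isconst_all by blast
  then show ?thesis by (simp add: killed_heat_0)
qed

text \<open>Jensen's inequality in tangent form: ln z \<le> z - 1 at z = \<phi> / u(x), multiplied
  by u(x)^2 and summed, gives \<phi> ln \<phi> \<le> <u^2 ln u> because the mass is at most 1. The
  log-Sobolev inequality returns half of \<phi> ln \<phi>; absorbing it doubles the
  constants.\<close>

lemma ln_l2norm_sq_le:
  assumes S: "finite S" and u: "\<And>x. u x \<ge> 0" "\<And>x. x \<notin> S \<Longrightarrow> u x = 0"
    and l1: "(\<Sum>x\<in>S. deg w x * u x) \<le> 1" and pos: "(\<Sum>x\<in>S. deg w x * (u x)\<^sup>2) > 0"
    and ls: "msum w (\<lambda>x. (u x)\<^sup>2 * ln (u x)) \<le> \<epsilon> * msum w (grad_form w u)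
      + M * (l2norm w u)\<^sup>2 + (l2norm w u)\<^sup>2 * ln (l2norm w u)"
  shows "ln (\<Sum>x\<in>S. deg w x * (u x)\<^sup>2) \<le>
    2 * \<epsilon> * msum w (grad_form w u) / (\<Sum>x\<in>S. deg w x * (u x)\<^sup>2) + 2 * M"
proof -
  define \<phi> where "\<phi> = (\<Sum>x\<in>S. deg w x * (u x)\<^sup>2)"
  have \<phi>: "\<phi> > 0" using pos by (simp add: \<phi>_def)
  have n: "(l2norm w u)\<^sup>2 = \<phi>" unfolding \<phi>_def by (rule l2norm_finite_support[OF S u(2)])
  have "l2norm w u > 0" using n \<phi> l2norm_nonneg[of u] by (metis less_eq_real_def power_zero_numeral less_irrefl)
  then have ln: "ln \<phi> = 2 * ln (l2norm w u)" unfolding n[symmetric] by (simp add: ln_realpow)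
  have "(u x)\<^sup>2 * (ln \<phi> - ln (u x)) \<le> \<phi> * u x - (u x)\<^sup>2" for x
  proof (cases "u x = 0")
    case False
    then have ux: "u x > 0" using u(1)[of x] by simp
    have "ln \<phi> - ln (u x) = ln (\<phi> / u x)" using \<phi> ux by (simp add: ln_div)
    also have "\<dots> \<le> \<phi> / u x - 1" using \<phi> ux by (intro ln_le_minus_one) simp
    finally have "(u x)\<^sup>2 * (ln \<phi> - ln (u x)) \<le> (u x)\<^sup>2 * (\<phi> / u x - 1)"
      by (intro mult_left_mono) auto
    also have "\<dots> = \<phi> * u x - (u x)\<^sup>2" using ux by (simp add: field_simps power2_eq_square)
    finally show ?thesis .
  qed simp
  then have "(\<Sum>x\<in>S. deg w x * ((u x)\<^sup>2 * (ln \<phi> - ln (u x)))) \<le> (\<Sum>x\<in>S. deg w x * (\<phi> * u x - (u x)\<^sup>2))"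
    by (intro sum_mono mult_left_mono) (auto simp: less_imp_le[OF deg_pos])
  also have "\<dots> = \<phi> * (\<Sum>x\<in>S. deg w x * u x) - \<phi>"
    by (simp add: right_diff_distrib sum_subtractf \<phi>_def[symmetric] mult.left_commute[of _ \<phi>]
        sum_distrib_left[symmetric])
  also have "\<dots> \<le> 0" using l1 \<phi> by simp
  finally have "\<phi> * ln \<phi> \<le> (\<Sum>x\<in>S. deg w x * ((u x)\<^sup>2 * ln (u x)))"
    by (simp add: right_diff_distrib sum_subtractf mult.assoc[symmetric] sum_distrib_right[symmetric]
        \<phi>_def[symmetric] mult.commute[of "ln \<phi>"])
  also have "\<dots> = msum w (\<lambda>x. (u x)\<^sup>2 * ln (u x))"
    by (rule msum_finite_support[OF S, symmetric]) (simp add: u)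
  finally have "\<phi> * ln \<phi> \<le> \<epsilon> * msum w (grad_form w u) + M * \<phi> + \<phi> * (ln \<phi> / 2)"
    using ls unfolding n ln by linarith
  then show ?thesis using \<phi> unfolding \<phi>_def[symmetric] by (simp add: field_simps)
qed

lemma sum_killed_heat_sq_le:
  assumes S: "finite S" and x: "x \<in> S" and t: "t > 0"
    and ls: "\<And>\<epsilon> f. \<epsilon> > 0 \<Longrightarrow> (\<And>x. f x \<ge> 0) \<Longrightarrow> finite {x. f x \<noteq> 0} \<Longrightarrow>
      msum w (\<lambda>x. (f x)\<^sup>2 * ln (f x)) \<le> \<epsilon> * msum w (grad_form w f)
        + (C' - N / 4 * ln \<epsilon>) * (l2norm w f)\<^sup>2 + (l2norm w f)\<^sup>2 * ln (l2norm w f)"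
  shows "(\<Sum>z\<in>S. deg w z * (killed_heat w S t (\<lambda>z. indicator {x} z / deg w x) z)\<^sup>2)
    \<le> exp (2 * C' + N / 2) * t powr (- (N / 2))"
proof -
  let ?f = "\<lambda>z. indicator {x} z / deg w x"
  define u where "u s = killed_heat w S s ?f" for s
  define \<phi> where "\<phi> s = (\<Sum>z\<in>S. deg w z * (u s z)\<^sup>2)" for s
  have b: "\<bar>?f z\<bar> \<le> 1 / deg w x" for z using deg_pos[of x] by (simp add: indicator_def)
  have f0: "?f z \<ge> 0" for z using deg_pos[of x] by (simp add: less_imp_le)
  have fS: "?f z = 0" if "z \<notin> S" for z using that x by (auto simp: indicator_def)
  have u0: "u s z \<ge> 0" if "s \<ge> 0" for s z
    unfolding u_def by (rule killed_heat_nonneg[OF b f0 that])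
  have uS: "u s z = 0" if "z \<notin> S" for s z
    unfolding u_def by (rule killed_heat_outside[OF fS that])
  have u': "((\<lambda>s. u s z) has_real_derivative avg w S (u s) z - u s z) (at s)" for s z
    unfolding u_def by (rule killed_heat_deriv[OF b])
  have l1: "(\<Sum>z\<in>S. deg w z * u s z) \<le> 1" if "s \<ge> 0" for s
  proof -
    have "(\<Sum>z\<in>S. deg w z * u s z) \<le> (\<Sum>z\<in>S. deg w z * ?f z)"
      unfolding u_def by (rule killed_heat_l1_le[OF S b f0 that])
    also have "\<dots> = (\<Sum>z\<in>{x}. deg w z * ?f z)"
      using S x by (intro sum.mono_neutral_right) auto
    also have "\<dots> = 1" using deg_pos[of x] by simp
    finally show ?thesis .
  qed
  have pos: "\<phi> s > 0" if "s \<ge> 0" for s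
  proof -
    have "0 < exp (- s) * ?f x" using deg_pos[of x] by simp
    also have "\<dots> \<le> u s x" unfolding u_def by (rule killed_heat_ge[OF b f0 that])
    finally have "0 < deg w x * (u s x)\<^sup>2" using deg_pos[of x] by simp
    also have "\<dots> \<le> \<phi> s" unfolding \<phi>_def
      using x S by (intro member_le_sum) (auto intro: mult_nonneg_nonneg less_imp_le[OF deg_pos])
    finally show ?thesis .
  qed
  have \<phi>': "(\<phi> has_real_derivative - 2 * msum w (grad_form w (u s))) (at s)" for s
  proof -
    have "(\<phi> has_real_derivative
        (\<Sum>z\<in>S. deg w z * (of_nat 2 * ((avg w S (u s) z - u s z) * u s z ^ (2 - Suc 0))))) (at s)"
      unfolding \<phi>_def[abs_def] by (intro DERIV_sum DERIV_cmult DERIV_power u')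
    also have "(\<Sum>z\<in>S. deg w z * (of_nat 2 * ((avg w S (u s) z - u s z) * u s z ^ (2 - Suc 0)))) =
        2 * ((\<Sum>z\<in>S. deg w z * avg w S (u s) z * u s z) - \<phi> s)"
      unfolding \<phi>_def sum_subtractf[symmetric] sum_distrib_left
      by (intro sum.cong refl) (simp add: algebra_simps power2_eq_square)
    also have "(\<Sum>z\<in>S. deg w z * avg w S (u s) z * u s z) = (\<Sum>z\<in>S. \<Sum>y\<in>S. w z y * (u s z * u s y))"
      by (intro sum.cong refl) (simp add: deg_avg[OF S] sum_distrib_left mult_ac)
    also have "2 * (\<dots> - \<phi> s) = - 2 * msum w (grad_form w (u s))"
      using msum_grad_form[OF S, of "u s"] uS by (simp add: \<phi>_def)
    finally show ?thesis .
  qed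
  \<comment> \<open>The terms after the first integrate (N/2) ln s - 2 C'. The factor s makes
    \<open>?g 0\<close> vanish whatever \<open>\<phi> 0\<close> = 1 / deg w x is, so the bound
    depends on neither \<open>S\<close> nor \<open>x\<close>.\<close>
  let ?g = "\<lambda>s. s * ln (\<phi> s) - 2 * C' * s + N / 2 * (s * ln s - s)"
  have "?g t \<le> ?g 0"
  proof (rule DERIV_nonpos_imp_decreasing_open[where f="?g" and a=0 and b=t])
    show "0 \<le> t" using t by simp
    fix s assume s: "0 < s" "s < t"
    let ?E = "msum w (grad_form w (u s))"
    have p: "\<phi> s > 0" using pos s by simp
    have "(?g has_real_derivative
        (ln (\<phi> s) + s * ((- 2 * ?E) / \<phi> s)) - 2 * C' + N / 2 * ln s) (at s)"
      using s p by (auto intro!: derivative_eq_intros \<phi>')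
    \<comment> \<open>The choice \<epsilon> = s makes the energy term cancel exactly against s
      \<phi>'/\<phi> in the derivative of \<open>?g\<close>.\<close>
    moreover have "ln (\<phi> s) \<le> 2 * s * ?E / \<phi> s + 2 * (C' - N / 4 * ln s)"
      unfolding \<phi>_def
    proof (rule ln_l2norm_sq_le[OF S])
      have "finite {z. u s z \<noteq> 0}" by (rule finite_subset[OF _ S]) (use uS in auto)
      then show "msum w (\<lambda>z. (u s z)\<^sup>2 * ln (u s z)) \<le> s * ?E
          + (C' - N / 4 * ln s) * (l2norm w (u s))\<^sup>2 + (l2norm w (u s))\<^sup>2 * ln (l2norm w (u s))"
        using u0 s by (intro ls) auto
    qed (use u0 uS l1 p s in \<open>auto simp: \<phi>_def\<close>)
    ultimately show "\<exists>y. (?g has_real_derivative y) (at s) \<and> y \<le> 0"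
      by (intro exI conjI) (auto simp: algebra_simps)
  next
    \<comment> \<open>s ln s is continuous but not differentiable at 0, so derivatives are taken
      inside the interval only.\<close>
    have c: "continuous_on {0..t} \<phi>"
      using \<phi>' by (intro DERIV_continuous_on) (rule has_field_derivative_at_within)
    have 1: "continuous_on {0..t} (\<lambda>s. s * ln s)"
      by (rule continuous_on_subset[OF continuous_on_mult_ln]) auto
    have 2: "continuous_on {0..t} (\<lambda>s. ln (\<phi> s))"
      by (intro continuous_on_ln c) (force dest: pos)
    show "continuous_on {0..t} ?g"
      by (intro 1 continuous_on_add continuous_on_diff continuous_on_mult[OF continuous_on_id 2]
          continuous_on_mult[OF continuous_on_const] continuous_on_const continuous_on_id)
  qed
  then have "t * ln (\<phi> t) \<le> t * (2 * C' + N / 2 - N / 2 * ln t)"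
    by (simp add: algebra_simps)
  then have "ln (\<phi> t) \<le> 2 * C' + N / 2 - N / 2 * ln t" using t by simp
  then have "exp (ln (\<phi> t)) \<le> exp (2 * C' + N / 2 - N / 2 * ln t)" by simp
  also have "\<dots> = exp (2 * C' + N / 2) * t powr (- (N / 2))"
    using t by (simp add: powr_def exp_add[symmetric])
  finally show ?thesis using pos[of t] t by (simp add: \<phi>_def u_def)
qed

section \<open>Exhaustion by finite sets and the heat kernel bound\<close>

text \<open>Each average spreads the support at most to neighbours, so n steps from a finite support
  stay finite by local finiteness. A set \<open>S\<close> containing all these supports makes
  killing invisible for n steps.\<close>

lemma avg_pow_exhaustion:
  assumes f: "finite {x. f x \<noteq> 0}" and X: "finite X"
  obtains S where "finite S" "X \<subseteq> S" "\<And>k. k \<le> n \<Longrightarrow> (avg w S ^^ k) f = (avg w UNIV ^^ k) f"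
proof -
  let ?A = "\<lambda>k. (avg w UNIV ^^ k) f"
  have fin: "finite {x. ?A k x \<noteq> 0}" for k
  proof (induction k)
    case (Suc k)
    have "{x. ?A (Suc k) x \<noteq> 0} \<subseteq> (\<Union>z\<in>{x. ?A k x \<noteq> 0}. nbrs w z)"
    proof
      fix x assume "x \<in> {x. ?A (Suc k) x \<noteq> 0}"
      then have "(\<Sum>y\<in>nbrs w x. w x y * ?A k y) \<noteq> 0" by (auto simp: avg_def)
      then obtain y where "y \<in> nbrs w x" "?A k y \<noteq> 0" by (metis (mono_tags, lifting) mult_zero_right sum.neutral)
      then show "x \<in> (\<Union>z\<in>{x. ?A k x \<noteq> 0}. nbrs w z)" using nbrs_sym by blast
    qed
    then show ?case by (rule finite_subset) (use Suc locally_finite in auto)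
  qed (simp add: f)
  define S where "S = X \<union> (\<Union>k\<le>n. {x. ?A k x \<noteq> 0})"
  have S: "?A k x = 0" if "k \<le> n" "x \<notin> S" for k x using that by (auto simp: S_def)
  show thesis
  proof
    show "finite S" "X \<subseteq> S" using fin X by (auto simp: S_def)
    show "(avg w S ^^ k) f = ?A k" if "k \<le> n" for k
      using that
    proof (induction k)
      case (Suc k)
      \<comment> \<open>Inside \<open>S\<close> the discarded neighbours carry the value 0; outside,
        the free average at step k + 1 is itself 0 by the choice of \<open>S\<close>.\<close>
      have step: "avg w S (?A k) x = avg w UNIV (?A k) x" for x
      proof (cases "x \<in> S")
        case True
        have "(\<Sum>y\<in>nbrs w x \<inter> S. w x y * ?A k y) = (\<Sum>y\<in>nbrs w x. w x y * ?A k y)"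
          using Suc.prems S[of k] by (intro sum.mono_neutral_left) (auto simp: locally_finite)
        then show ?thesis using True by (simp add: avg_def)
      next
        case False
        then show ?thesis using S[OF Suc.prems, of x] by (simp add: avg_def[of w S])
      qed
      have IH: "(avg w S ^^ k) f = ?A k" using Suc by simp
      show ?case unfolding funpow.simps o_apply IH by (rule ext) (rule step)
    qed simp
  qed
qed

text \<open>\<open>S\<close> varies with the number n of series terms, but the bound does not, so it
  survives the limit. The factor \<open>2 powr (N / 2)\<close> comes from using the decay estimate
  at time t / 2.\<close>

lemma heat_kernel_le_of_log_sobolev:
  assumes t: "t > 0"
    and ls: "\<And>\<epsilon> f. \<epsilon> > 0 \<Longrightarrow> (\<And>x. f x \<ge> 0) \<Longrightarrow> finite {x. f x \<noteq> 0} \<Longrightarrow>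
      msum w (\<lambda>x. (f x)\<^sup>2 * ln (f x)) \<le> \<epsilon> * msum w (grad_form w f)
        + (C' - N / 4 * ln \<epsilon>) * (l2norm w f)\<^sup>2 + (l2norm w f)\<^sup>2 * ln (l2norm w f)"
  shows "heat_kernel w t x y \<le> exp (2 * C' + N / 2) * 2 powr (N / 2) * t powr (- (N / 2))"
proof -
  let ?K = "exp (2 * C' + N / 2) * (t / 2) powr (- (N / 2))"
  let ?f = "\<lambda>y z. indicator {y} z / deg w y"
  have f0: "?f y z \<ge> 0" for y z by (simp add: less_imp_le[OF deg_pos])
  have partial: "exp (- t) * (\<Sum>k<n. t ^ k / fact k * (avg w UNIV ^^ k) (?f y) x) \<le> ?K" for n
  proof -
    have fin: "finite {z. ?f y z \<noteq> 0}"
      by (rule finite_subset[of _ "{y}"]) (auto simp: indicator_def)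
    obtain S where S: "finite S" "{x, y} \<subseteq> S"
      "\<And>k. k \<le> n \<Longrightarrow> (avg w S ^^ k) (?f y) = (avg w UNIV ^^ k) (?f y)"
      by (rule avg_pow_exhaustion[where f="?f y" and X="{x, y}" and n=n, OF fin]) (simp, blast)
    define u where "u y = killed_heat w S (t / 2) (?f y)" for y
    have "exp (- t) * (\<Sum>k<n. t ^ k / fact k * (avg w UNIV ^^ k) (?f y) x) =
        exp (- t) * (\<Sum>k<n. t ^ k / fact k * (avg w S ^^ k) (?f y) x)"
      by (intro arg_cong[where f="\<lambda>a. exp (- t) * a"] sum.cong refl) (subst S(3), auto)
    also have "\<dots> \<le> killed_heat w S t (?f y) x"
      by (rule killed_heat_partial_sum_le[OF abs_point_mass_le f0]) (use t in simp)
    \<comment> \<open>Pairing with the unit point mass at \<open>x\<close> reads off the value at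
      \<open>x\<close>, which makes \<open>killed_heat_pairing\<close> applicable.\<close>
    also have "\<dots> = (\<Sum>z\<in>{x}. deg w z * (killed_heat w S t (?f y) z * ?f x z))"
      using deg_pos[of x] by simp
    also have "\<dots> = (\<Sum>z\<in>S. deg w z * (killed_heat w S t (?f y) z * ?f x z))"
      using S(1,2) by (intro sum.mono_neutral_left) auto
    also have "\<dots> = (\<Sum>z\<in>S. deg w z * (u y z * u x z))"
      using killed_heat_pairing[where f="?f y" and g="?f x" and t="t / 2",
          OF S(1) abs_point_mass_le abs_point_mass_le]
      by (simp add: u_def)
    \<comment> \<open>2ab \<le> a^2 + b^2 reduces the off-diagonal value to the squared norms of the
      flows started at \<open>x\<close> and \<open>y\<close>.\<close>
    also have "\<dots> \<le> (\<Sum>z\<in>S. (deg w z * (u y z)\<^sup>2 + deg w z * (u x z)\<^sup>2) / 2)"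
    proof (rule sum_mono)
      fix z
      have "u y z * u x z \<le> ((u y z)\<^sup>2 + (u x z)\<^sup>2) / 2"
        using sum_squares_bound[of "u y z" "u x z"] by simp
      then have "deg w z * (u y z * u x z) \<le> deg w z * (((u y z)\<^sup>2 + (u x z)\<^sup>2) / 2)"
        by (intro mult_left_mono less_imp_le[OF deg_pos])
      then show "deg w z * (u y z * u x z) \<le> (deg w z * (u y z)\<^sup>2 + deg w z * (u x z)\<^sup>2) / 2"
        by (simp add: distrib_left)
    qed
    also have "\<dots> = ((\<Sum>z\<in>S. deg w z * (u y z)\<^sup>2) + (\<Sum>z\<in>S. deg w z * (u x z)\<^sup>2)) / 2"
      by (simp only: sum_divide_distrib[symmetric] sum.distrib)
    also have "\<dots> \<le> ?K"
    proof -
      have "(\<Sum>z\<in>S. deg w z * (u v z)\<^sup>2) \<le> ?K" if "v \<in> S" for v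
        unfolding u_def by (rule sum_killed_heat_sq_le[OF S(1) that _ ls]) (use t in auto)
      from this[of x] this[of y] show ?thesis using S(2) by simp
    qed
    finally show ?thesis .
  qed
  have "(\<Sum>k. t ^ k / fact k * (avg w UNIV ^^ k) (?f y) x) \<le> exp t * ?K"
  proof (rule suminf_le_const[OF killed_heat_summable[where f="?f y", OF abs_point_mass_le]])
    fix n
    have "exp t * (exp (- t) * (\<Sum>k<n. t ^ k / fact k * (avg w UNIV ^^ k) (?f y) x)) \<le> exp t * ?K"
      by (intro mult_left_mono partial) auto
    then show "(\<Sum>k<n. t ^ k / fact k * (avg w UNIV ^^ k) (?f y) x) \<le> exp t * ?K"
      by (simp only: mult.assoc[symmetric] exp_add[symmetric] add.right_inverse exp_zero mult_1)
  qed
  then have "heat_kernel w t x y \<le> exp (- t) * (exp t * ?K)"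
    unfolding heat_kernel_eq_killed_heat killed_heat_def by (intro mult_left_mono) auto
  also have "\<dots> = ?K"
    unfolding mult.assoc[symmetric] exp_add[symmetric, of "- t" t] by simp
  also have "(t / 2) powr (- (N / 2)) = 2 powr (N / 2) * t powr (- (N / 2))"
    using t by (simp add: powr_divide powr_minus field_simps)
  finally show ?thesis by (simp only: mult.assoc)
qed

end

section \<open>Assembling the two implications\<close>

theorem theorem3p4:
  fixes w :: "'v \<Rightarrow> 'v \<Rightarrow> real" and N :: real
  assumes "infinite (UNIV :: 'v set)"
    and "weighted_graph w"
    and "N > 0"
  shows "(\<exists>C>0. \<forall>t>0.
            (SUP (x, y)\<in>UNIV. ereal (heat_kernel w t x y)) \<le> ereal (C * t powr (- (N / 2))))
     \<longleftrightarrow>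
         (\<exists>C'>0. \<forall>\<epsilon>>0. \<forall>f :: 'v \<Rightarrow> real. (\<forall>x. f x \<ge> 0) \<longrightarrow> finite {x. f x \<noteq> 0} \<longrightarrow>
            msum w (\<lambda>x. (f x)\<^sup>2 * ln (f x))
              \<le> \<epsilon> * msum w (grad_form w f)
                + (C' - N / 4 * ln \<epsilon>) * (l2norm w f)\<^sup>2
                + (l2norm w f)\<^sup>2 * ln (l2norm w f))"
proof
  interpret weighted_graph w by fact
  assume "\<exists>C>0. \<forall>t>0. (SUP (x, y)\<in>UNIV. ereal (heat_kernel w t x y)) \<le> ereal (C * t powr (- (N / 2)))"
  then obtain C where C: "C > 0"
    and sup: "\<And>t. t > 0 \<Longrightarrow>
      (SUP (x, y)\<in>UNIV. ereal (heat_kernel w t x y)) \<le> ereal (C * t powr (- (N / 2)))"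
    by blast
  have K: "heat_kernel w t x y \<le> C * t powr (- (N / 2))" if "t > 0" for t x y
  proof -
    have "ereal (heat_kernel w t x y) \<le> (SUP (x, y)\<in>UNIV. ereal (heat_kernel w t x y))"
      by (rule SUP_upper2[of "(x, y)"]) auto
    also note sup[OF that]
    finally show ?thesis by simp
  qed
  \<comment> \<open>ln C / 2 may be negative while \<open>C'\<close> must be positive; enlarging
    \<open>C'\<close> only weakens the inequality.\<close>
  define C' where "C' = max 1 (ln C / 2)"
  show "\<exists>C'>0. \<forall>\<epsilon>>0. \<forall>f :: 'v \<Rightarrow> real. (\<forall>x. f x \<ge> 0) \<longrightarrow> finite {x. f x \<noteq> 0} \<longrightarrow>
            msum w (\<lambda>x. (f x)\<^sup>2 * ln (f x))
              \<le> \<epsilon> * msum w (grad_form w f)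
                + (C' - N / 4 * ln \<epsilon>) * (l2norm w f)\<^sup>2
                + (l2norm w f)\<^sup>2 * ln (l2norm w f)"
  proof (intro exI[of _ C'] conjI allI impI)
    show "C' > 0" by (simp add: C'_def)
    fix \<epsilon> :: real and f :: "'v \<Rightarrow> real"
    assume \<epsilon>: "\<epsilon> > 0" and f: "\<forall>x. f x \<ge> 0" "finite {x. f x \<noteq> 0}"
    have "(ln C / 2 - N / 4 * ln \<epsilon>) * (l2norm w f)\<^sup>2 \<le> (C' - N / 4 * ln \<epsilon>) * (l2norm w f)\<^sup>2"
      by (intro mult_right_mono) (auto simp: C'_def)
    with log_sobolev_of_heat_kernel_bound[OF C K[OF \<epsilon>] \<epsilon>, of f] f
    show "msum w (\<lambda>x. (f x)\<^sup>2 * ln (f x)) \<le> \<epsilon> * msum w (grad_form w f)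
        + (C' - N / 4 * ln \<epsilon>) * (l2norm w f)\<^sup>2 + (l2norm w f)\<^sup>2 * ln (l2norm w f)"
      by fastforce
  qed
next
  interpret weighted_graph w by fact
  assume "\<exists>C'>0. \<forall>\<epsilon>>0. \<forall>f :: 'v \<Rightarrow> real. (\<forall>x. f x \<ge> 0) \<longrightarrow> finite {x. f x \<noteq> 0} \<longrightarrow>
            msum w (\<lambda>x. (f x)\<^sup>2 * ln (f x))
              \<le> \<epsilon> * msum w (grad_form w f)
                + (C' - N / 4 * ln \<epsilon>) * (l2norm w f)\<^sup>2
                + (l2norm w f)\<^sup>2 * ln (l2norm w f)"
  then obtain C' where ls: "\<And>\<epsilon> f. \<epsilon> > 0 \<Longrightarrow> (\<And>x. f x \<ge> 0) \<Longrightarrow> finite {x. f x \<noteq> 0} \<Longrightarrow>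
      msum w (\<lambda>x. (f x)\<^sup>2 * ln (f x)) \<le> \<epsilon> * msum w (grad_form w f)
        + (C' - N / 4 * ln \<epsilon>) * (l2norm w f)\<^sup>2 + (l2norm w f)\<^sup>2 * ln (l2norm w f)"
    by blast
  let ?C = "exp (2 * C' + N / 2) * 2 powr (N / 2)"
  have "(SUP (x, y)\<in>UNIV. ereal (heat_kernel w t x y)) \<le> ereal (?C * t powr (- (N / 2)))"
    if "t > 0" for t
    by (rule SUP_least) (use heat_kernel_le_of_log_sobolev[OF that ls] in auto)
  moreover have "?C > 0" by simp
  ultimately show "\<exists>C>0. \<forall>t>0.
      (SUP (x, y)\<in>UNIV. ereal (heat_kernel w t x y)) \<le> ereal (C * t powr (- (N / 2)))"
    by blast
qed

end
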